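(* Let $M$ be a nilpotent matroid of rank $r$ on $[n]$. Then, for every $q\in\mathbb{C}^r$, all minors of size $n-\dim(M)+1$ of the liftability matrix $\mathcal{M}_q(M)$ lie in the matroid ideal $I_M$.
   Context: Subspaces. For a matroid $M$ of rank $r$ on $[n]=\{1,\dots,n\}$, two circuits of size less than $r+1$ are equivalent if they have the same closure. The equivalence classes are the subspaces of $M$, forming the set $\mathfrak{S}_M$. A point $p\in[n]$ belongs to $l\in\mathfrak{S}_M$ if $p\in C$ for some circuit $C\in l$; $l$ is identified with its set of points; $\mathfrak{S}_p$ is the set of subspaces containing $p$. A subset $N\subset[n]$ is identified with the restriction $M|N$, whose subspaces are those of $M|N$ as a matroid in its own right. Nilpotent. $S_M=\{p:|\mathfrak{S}_p|>1\}$; the nilpotent chain is $M_0=M$, $M_1=S_M$, $M_{j+1}=S_{M_j}$. $M$ is nilpotent if $M_j=\emptyset$ for some $j$. Varieties. A realization of $M$ is a family $\gamma=(\gamma_1,\dots,\gamma_n)$ of vectors of $\mathbb{C}^r$ whose linearly dependent subfamilies are exactly those indexed by dependent sets of $M$. $\Gamma_M$ is the set of realizations, $V_M$ its Zariski closure in $\mathbb{C}^{rn}$, and $I_M=I(V_M)\subset\mathbb{C}[X]$ the vanishing ideal, with $X$ an $r\times n$ matrix of indeterminates with columns indexed by $[n]$. $V_{\mathcal{C}(M)}$ is the set of families $\gamma\in(\mathbb{C}^r)^n$ with $(\gamma_i)_{i\in A}$ linearly dependent for every dependent set $A$ of $M$. Liftability matrix. For $q\in\mathbb{C}^r$, $\mathcal{M}_q(M)$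 is the matrix with entries in $\mathbb{C}[X]$, with columns indexed by $[n]$ and rows indexed by pairs $(c,K)$, where $c=\{c_1,\dots,c_k\}$ is a circuit of $M$ and $K\in\binom{[r]}{k}$ with $k=|c|$. In the row $(c,K)$, the entry in column $c_i$ is $(-1)^{i-1}[c_1,\dots,\widehat{c_i},\dots,c_k,q]_K$, the determinant of the $k\times k$ submatrix with rows $K$ of the matrix whose columns are the columns $c_1,\dots,\widehat{c_i},\dots,c_k$ of $X$ (omitting $c_i$) followed by $q$. All other entries of the row are $0$. The number $\dim(M)$. For $\gamma\in\Gamma_M$ and $q\in\mathbb{C}^r$, let $\dim_q(\gamma)$ be the dimension of the linear space of $(z_p)_{p\in[n]}\in\mathbb{C}^n$ such that $(\gamma_p+z_pq)_{p\in[n]}\in V_{\mathcal{C}(M)}$. A vector $q$ is outside $\gamma$ if $q\notin\gamma_l=\langle\gamma_p:p\in l\rangle$ for every $l\in\mathfrak{S}_M$. For $M$ nilpotent, $\dim_q(\gamma)$ has the same value for all $\gamma\in\Gamma_M$ and all $q$ outside $\gamma$; this common value is denoted $\dim(M)$. *)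

theory Defs
  imports "Jordan_Normal_Form.DL_Rank_Submatrix" "HOL-Library.Poly_Mapping"
begin

section \<open>Matroids\<close>

record 'a matroid =
  ground :: "'a set"
  indep :: "'a set set"

definition is_matroid :: "'a matroid \<Rightarrow> bool" where
  "is_matroid M \<longleftrightarrow>
     finite (ground M) \<and> indep M \<subseteq> Pow (ground M) \<and> {} \<in> indep M \<and>
     (\<forall>A B. A \<subseteq> B \<and> B \<in> indep M \<longrightarrow> A \<in> indep M) \<and>
     (\<forall>A \<in> indep M. \<forall>B \<in> indep M. card A < card B \<longrightarrow> (\<exists>x \<in> B - A. insert x A \<in> indep M))"

definition dependent_set :: "'a matroid \<Rightarrow> 'a set \<Rightarrow> bool" where
  "dependent_set M A \<longleftrightarrow> A \<subseteq> ground M \<and> A \<notin> indep M"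

definition circuit :: "'a matroid \<Rightarrow> 'a set \<Rightarrow> bool" where
  "circuit M C \<longleftrightarrow> dependent_set M C \<and> (\<forall>A. A \<subset> C \<longrightarrow> \<not> dependent_set M A)"

definition rank_of :: "'a matroid \<Rightarrow> 'a set \<Rightarrow> nat" where
  "rank_of M A = Max (card ` {I \<in> indep M. I \<subseteq> A})"

definition matroid_rank :: "'a matroid \<Rightarrow> nat" where
  "matroid_rank M = rank_of M (ground M)"

definition matroid_closure :: "'a matroid \<Rightarrow> 'a set \<Rightarrow> 'a set" where
  "matroid_closure M A = {x \<in> ground M. rank_of M (insert x A) = rank_of M A}"

definition matroid_restrict :: "'a matroid \<Rightarrow> 'a set \<Rightarrow> 'a matroid" where
  "matroid_restrict M N = \<lparr>ground = N, indep = {I \<in> indep M. I \<subseteq> N}\<rparr>"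

section \<open>Subspaces and nilpotency\<close>

definition small_circuits :: "'a matroid \<Rightarrow> 'a set set" where
  "small_circuits M = {C. circuit M C \<and> card C < matroid_rank M + 1}"

definition closure_equiv :: "'a matroid \<Rightarrow> ('a set \<times> 'a set) set" where
  "closure_equiv M = {(C, D). C \<in> small_circuits M \<and> D \<in> small_circuits M \<and>
     matroid_closure M C = matroid_closure M D}"

text \<open>A subspace is an equivalence class \<open>l\<close> of circuits; its set of points is \<open>\<Union>l\<close>.\<close>

definition subspaces :: "'a matroid \<Rightarrow> 'a set set set" where
  "subspaces M = small_circuits M // closure_equiv M"

definition subspaces_at :: "'a matroid \<Rightarrow> 'a \<Rightarrow> 'a set set set" where
  "subspaces_at M p = {l \<in> subspaces M. p \<in> \<Union>l}"

definition multi_points :: "'a matroid \<Rightarrow> 'a set" where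
  "multi_points M = {p \<in> ground M. card (subspaces_at M p) > 1}"

primrec nilpotent_chain :: "'a matroid \<Rightarrow> nat \<Rightarrow> 'a matroid" where
  "nilpotent_chain M 0 = M"
| "nilpotent_chain M (Suc j) =
     matroid_restrict (nilpotent_chain M j) (multi_points (nilpotent_chain M j))"

definition nilpotent_matroid :: "'a matroid \<Rightarrow> bool" where
  "nilpotent_matroid M \<longleftrightarrow> (\<exists>j. ground (nilpotent_chain M j) = {})"

section \<open>Realizations\<close>

text \<open>
  Indices start at \<open>0\<close>: \<open>[n]\<close> is \<open>{..<n}\<close> and \<open>[r]\<close> is \<open>{..<r}\<close>.
  A family of \<open>n\<close> vectors of \<open>\<complex>\<^sup>r\<close> is an \<open>r \<times> n\<close> matrix whose columns are the
  members of the family. Dependence is that of families, so two equal columns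
  at different positions are dependent.
\<close>

definition dependent_family :: "complex mat \<Rightarrow> nat set \<Rightarrow> bool" where
  "dependent_family \<gamma> A \<longleftrightarrow>
     (\<exists>a :: nat \<Rightarrow> complex. (\<exists>p \<in> A. a p \<noteq> 0) \<and>
        (\<forall>i < dim_row \<gamma>. (\<Sum>p \<in> A. a p * \<gamma> $$ (i, p)) = 0))"

definition realizations :: "nat \<Rightarrow> nat \<Rightarrow> nat matroid \<Rightarrow> complex mat set" where
  "realizations r n M = {\<gamma> \<in> carrier_mat r n.
     \<forall>A \<subseteq> {..<n}. dependent_family \<gamma> A \<longleftrightarrow> dependent_set M A}"

definition circuit_variety :: "nat \<Rightarrow> nat \<Rightarrow> nat matroid \<Rightarrow> complex mat set" where
  "circuit_variety r n M = {\<gamma> \<in> carrier_mat r n.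
     \<forall>A. dependent_set M A \<longrightarrow> dependent_family \<gamma> A}"

section \<open>The polynomial ring, Zariski closure and the matroid ideal\<close>

text \<open>
  Polynomials are finitely supported maps from monomials to coefficients, with the
  convolution product of the library; the indeterminate \<open>X\<^sub>i\<^sub>j\<close> is indexed by \<open>(i, j)\<close>.
  The type has infinitely many indeterminates; \<open>poly_ring r n\<close> is the subring \<open>\<complex>[X]\<close> of
  polynomials in the entries of an \<open>r \<times> n\<close> matrix.
\<close>

type_synonym mpoly = "((nat \<times> nat) \<Rightarrow>\<^sub>0 nat) \<Rightarrow>\<^sub>0 complex"

definition Const :: "complex \<Rightarrow> mpoly" where
  "Const a = Poly_Mapping.single 0 a"

definition Var :: "nat \<times> nat \<Rightarrow> mpoly" where
  "Var v = Poly_Mapping.single (Poly_Mapping.single v 1) 1"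

definition poly_ring :: "nat \<Rightarrow> nat \<Rightarrow> mpoly set" where
  "poly_ring r n = {f. \<forall>m \<in> Poly_Mapping.keys f. Poly_Mapping.keys m \<subseteq> {..<r} \<times> {..<n}}"

definition poly_eval :: "mpoly \<Rightarrow> complex mat \<Rightarrow> complex" where
  "poly_eval f \<gamma> = (\<Sum>m \<in> Poly_Mapping.keys f. Poly_Mapping.lookup f m *
     (\<Prod>v \<in> Poly_Mapping.keys m. (\<gamma> $$ v) ^ Poly_Mapping.lookup m v))"

definition zero_locus :: "nat \<Rightarrow> nat \<Rightarrow> mpoly set \<Rightarrow> complex mat set" where
  "zero_locus r n F = {\<gamma> \<in> carrier_mat r n. \<forall>f \<in> F. poly_eval f \<gamma> = 0}"

definition zariski_closed :: "nat \<Rightarrow> nat \<Rightarrow> complex mat set \<Rightarrow> bool" where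
  "zariski_closed r n S \<longleftrightarrow> (\<exists>F \<subseteq> poly_ring r n. S = zero_locus r n F)"

definition vanishing_ideal :: "nat \<Rightarrow> nat \<Rightarrow> complex mat set \<Rightarrow> mpoly set" where
  "vanishing_ideal r n S = {f \<in> poly_ring r n. \<forall>\<gamma> \<in> S. poly_eval f \<gamma> = 0}"

definition matroid_variety :: "nat \<Rightarrow> nat \<Rightarrow> nat matroid \<Rightarrow> complex mat set" where
  "matroid_variety r n M = zariski_closed r n hull realizations r n M"

definition matroid_ideal :: "nat \<Rightarrow> nat \<Rightarrow> nat matroid \<Rightarrow> mpoly set" where
  "matroid_ideal r n M = vanishing_ideal r n (matroid_variety r n M)"

section \<open>The liftability matrix\<close>

definition generic_matrix :: "nat \<Rightarrow> nat \<Rightarrow> mpoly mat" where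
  "generic_matrix r n = mat r n Var"

text \<open>The bracket \<open>[v\<^sub>1, \<dots>, v\<^sub>s, q]\<^sub>K\<close>.\<close>

definition bracket :: "nat \<Rightarrow> nat \<Rightarrow> complex vec \<Rightarrow> nat set \<Rightarrow> nat list \<Rightarrow> mpoly" where
  "bracket r n q K vs =
     det (submatrix (mat_of_cols r (map (col (generic_matrix r n)) vs @ [map_vec Const q])) K UNIV)"

definition liftability_rows :: "nat \<Rightarrow> nat matroid \<Rightarrow> (nat set \<times> nat set) set" where
  "liftability_rows r M = {(c, K). circuit M c \<and> K \<subseteq> {..<r} \<and> card K = card c}"

text \<open>
  The elements of a circuit are listed increasingly; \<open>card {x \<in> c. x < p}\<close> is the
  zero-based position of \<open>p\<close>, that is, the exponent \<open>i - 1\<close> for \<open>p = c\<^sub>i\<close>.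
\<close>

fun liftability_matrix ::
  "nat \<Rightarrow> nat \<Rightarrow> complex vec \<Rightarrow> nat set \<times> nat set \<Rightarrow> nat \<Rightarrow> mpoly" where
  "liftability_matrix r n q (c, K) p =
     (if p \<in> c
      then (-1) ^ card {x \<in> c. x < p} * bracket r n q K (sorted_list_of_set (c - {p}))
      else 0)"

text \<open>
  Minors of a matrix whose rows and columns are indexed by arbitrary sets. All orderings of
  the chosen rows and columns are admitted, so a minor is included with both signs.
\<close>

definition minors :: "nat \<Rightarrow> 'i set \<Rightarrow> 'j set \<Rightarrow> ('i \<Rightarrow> 'j \<Rightarrow> 'a :: comm_ring_1) \<Rightarrow> 'a set" where
  "minors m R C A = {det (mat m m (\<lambda>(i, j). A (rs ! i) (cs ! j))) | rs cs.
     distinct rs \<and> length rs = m \<and> set rs \<subseteq> R \<and>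
     distinct cs \<and> length cs = m \<and> set cs \<subseteq> C}"

section \<open>The number dim(M)\<close>

definition lift :: "complex mat \<Rightarrow> complex vec \<Rightarrow> complex vec \<Rightarrow> complex mat" where
  "lift \<gamma> q z = mat (dim_row \<gamma>) (dim_col \<gamma>) (\<lambda>(i, p). \<gamma> $$ (i, p) + z $ p * q $ i)"

definition lift_space ::
  "nat \<Rightarrow> nat \<Rightarrow> nat matroid \<Rightarrow> complex vec \<Rightarrow> complex mat \<Rightarrow> complex vec set" where
  "lift_space r n M q \<gamma> = {z \<in> carrier_vec n. lift \<gamma> q z \<in> circuit_variety r n M}"

definition dim_lift :: "nat \<Rightarrow> nat \<Rightarrow> nat matroid \<Rightarrow> complex vec \<Rightarrow> complex mat \<Rightarrow> nat" where
  "dim_lift r n M q \<gamma> = vectorspace.dim class_ring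
     (module_vec TYPE(complex) n \<lparr>carrier := lift_space r n M q \<gamma>\<rparr>)"

definition outside :: "nat \<Rightarrow> nat matroid \<Rightarrow> complex vec \<Rightarrow> complex mat \<Rightarrow> bool" where
  "outside r M q \<gamma> \<longleftrightarrow> q \<in> carrier_vec r \<and>
     (\<forall>l \<in> subspaces M.
        q \<notin> LinearCombinations.module.span class_ring (module_vec TYPE(complex) r) (col \<gamma> ` \<Union>l))"

text \<open>
  The common value of \<open>dim_lift\<close>. It is meaningful for nilpotent matroids that have a
  realization; without realizations it is unspecified, and the matroid ideal is all of
  \<open>poly_ring r n\<close>.
\<close>

definition matroid_dim :: "nat \<Rightarrow> nat \<Rightarrow> nat matroid \<Rightarrow> nat" where
  "matroid_dim r n M = (THE d. \<forall>\<gamma> \<in> realizations r n M. \<forall>q.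
     outside r M q \<gamma> \<longrightarrow> dim_lift r n M q \<gamma> = d)"

end

theory Submission
  imports Defs "HOL-Computational_Algebra.Polynomial"
begin

text \<open>
  Fix a realization \<open>\<gamma>\<close>. Up to a factor, a circuit \<open>C\<close> carries exactly one linear relation
  \<open>\<Sum>\<^sub>p a\<^sub>p \<gamma>\<^sub>p = 0\<close>, and all its coefficients are nonzero. Let \<open>L\<^sub>\<gamma>\<close> be the space of
  those \<open>z \<in> \<complex>\<^sup>n\<close> with \<open>\<Sum>\<^sub>p a\<^sub>p z\<^sub>p = 0\<close> for the relations \<open>a\<close> of all circuits with at most
  \<open>r\<close> elements (\<open>lift_solutions\<close>). Three facts give the theorem.

  For \<open>q\<close> outside \<open>\<gamma>\<close>, the family \<open>\<gamma> + z q\<close> lies in the circuit variety if and only if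
  \<open>z \<in> L\<^sub>\<gamma>\<close>, so that \<open>dim_lift\<close> is the dimension of \<open>L\<^sub>\<gamma>\<close> (\<open>lift_space_iff\<close>). A vector \<open>q\<close>
  outside \<open>\<gamma>\<close> exists, because the subspaces of \<open>M\<close> span proper subspaces of \<open>\<complex>\<^sup>r\<close>, and a point
  of the moment curve avoids finitely many hyperplanes (\<open>outside_exists\<close>).

  If \<open>M\<close> is nilpotent, there is a set \<open>B \<subseteq> [n]\<close> that does not depend on \<open>\<gamma>\<close> such that the
  restriction \<open>L\<^sub>\<gamma> \<rightarrow> \<complex>\<^sup>B\<close> is bijective for all \<open>\<gamma>\<close> (\<open>nilpotent_coordinate_set\<close>). Hence
  \<open>dim(M) = |B|\<close> as soon as \<open>M\<close> has a realization. The set \<open>B\<close> is built along the nilpotent chain, read backwards, by adding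
  one point \<open>p\<close> at a time to a set \<open>N\<close> of points (\<open>coordinate_set_extend\<close>). If no small circuit
  in \<open>N \<union> {p}\<close> contains \<open>p\<close>, then \<open>z\<^sub>p\<close> is free and \<open>p\<close> is added to \<open>B\<close>. Otherwise \<open>z\<^sub>p\<close> is
  determined by one such circuit. The other small circuits through \<open>p\<close> impose the same value:
  eliminating \<open>p\<close> from two relations leaves a relation on a set of rank less than \<open>r\<close>, and such a
  relation is a combination of relations of small circuits in \<open>N\<close>
  (\<open>low_rank_relation_killed\<close>). The bound on the rank holds since a point that is removed in the
  nilpotent chain lies in at most one subspace (\<open>low_rank_of_single_point\<close>).

  For every \<open>q\<close>, each row of the liftability matrix, evaluated at \<open>\<gamma>\<close>, is orthogonal to \<open>L\<^sub>\<gamma>\<close>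
  (\<open>liftability_row_kills\<close>): the product of the row \<open>(c, K)\<close> with \<open>z\<close> is, up to a sign, a Laplace
  expansion of a determinant whose columns satisfy the linear relation of \<open>c\<close>. A choice of
  \<open>n - dim(M) + 1\<close> columns leaves out \<open>dim(M) - 1\<close> columns, so some nonzero \<open>z \<in> L\<^sub>\<gamma>\<close> is
  supported on the chosen columns, and every minor on them vanishes at \<open>\<gamma>\<close>. The minors thus
  vanish on all realizations, hence on their Zariski closure.
\<close>

section \<open>Evaluation of polynomials\<close>

text \<open>
  The value of the monomial with exponents \<open>m\<close> at the matrix \<open>\<gamma>\<close>.
\<close>

definition monom_eval :: "complex mat \<Rightarrow> ((nat \<times> nat) \<Rightarrow>\<^sub>0 nat) \<Rightarrow> complex" where
  "monom_eval \<gamma> m = (\<Prod>v \<in> Poly_Mapping.keys m. (\<gamma> $$ v) ^ Poly_Mapping.lookup m v)"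

lemma monom_eval_superset:
  assumes "finite S" "Poly_Mapping.keys m \<subseteq> S"
  shows "monom_eval \<gamma> m = (\<Prod>v \<in> S. (\<gamma> $$ v) ^ Poly_Mapping.lookup m v)"
  unfolding monom_eval_def
  by (rule prod.mono_neutral_left) (use assms in \<open>auto simp: in_keys_iff\<close>)

lemma monom_eval_zero [simp]: "monom_eval \<gamma> 0 = 1"
  by (simp add: monom_eval_def)

lemma monom_eval_add: "monom_eval \<gamma> (m + m') = monom_eval \<gamma> m * monom_eval \<gamma> m'"
proof -
  let ?S = "Poly_Mapping.keys m \<union> Poly_Mapping.keys m'"
  have "monom_eval \<gamma> (m + m') = (\<Prod>v \<in> ?S. (\<gamma> $$ v) ^ Poly_Mapping.lookup (m + m') v)"
    by (rule monom_eval_superset) (use keys_add[of m m'] in auto)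
  also have "\<dots> = (\<Prod>v \<in> ?S. (\<gamma> $$ v) ^ Poly_Mapping.lookup m v) *
      (\<Prod>v \<in> ?S. (\<gamma> $$ v) ^ Poly_Mapping.lookup m' v)"
    by (simp add: lookup_add power_add prod.distrib)
  also have "\<dots> = monom_eval \<gamma> m * monom_eval \<gamma> m'"
    using monom_eval_superset[of ?S m] monom_eval_superset[of ?S m'] by simp
  finally show ?thesis .
qed

lemma poly_eval_superset:
  assumes "finite S" "Poly_Mapping.keys f \<subseteq> S"
  shows "poly_eval f \<gamma> = (\<Sum>m \<in> S. Poly_Mapping.lookup f m * monom_eval \<gamma> m)"
  unfolding poly_eval_def monom_eval_def
  by (rule sum.mono_neutral_left) (use assms in \<open>auto simp: in_keys_iff\<close>)

lemma poly_eval_zero [simp]: "poly_eval 0 \<gamma> = 0"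
  by (simp add: poly_eval_def)

lemma poly_eval_single [simp]: "poly_eval (Poly_Mapping.single m c) \<gamma> = c * monom_eval \<gamma> m"
  by (subst poly_eval_superset[of "{m}"]) auto

lemma poly_eval_add: "poly_eval (f + g) \<gamma> = poly_eval f \<gamma> + poly_eval g \<gamma>"
proof -
  let ?S = "Poly_Mapping.keys f \<union> Poly_Mapping.keys g"
  show ?thesis
    using poly_eval_superset[of ?S f \<gamma>] poly_eval_superset[of ?S g \<gamma>]
      poly_eval_superset[of ?S "f + g" \<gamma>] keys_add[of f g]
    by (simp add: lookup_add sum.distrib algebra_simps)
qed

lemma mpoly_induct [case_names zero add]:
  fixes f :: mpoly
  assumes "P 0" and "\<And>m c f. P f \<Longrightarrow> P (Poly_Mapping.single m c + f)"
  shows "P f"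
proof (induction f rule: update_induct)
  case (update f m c)
  have "Poly_Mapping.update m c f = Poly_Mapping.single m c + f"
    by (rule poly_mapping_eqI)
      (use update(1) in \<open>auto simp: lookup_update lookup_add lookup_single in_keys_iff\<close>)
  then show ?case using assms(2)[OF update(3)] by simp
qed fact

lemma poly_eval_mult: "poly_eval (f * g) \<gamma> = poly_eval f \<gamma> * poly_eval g \<gamma>"
proof (induction f rule: mpoly_induct)
  case (add m c f)
  have "poly_eval (Poly_Mapping.single m c * g) \<gamma> = c * monom_eval \<gamma> m * poly_eval g \<gamma>"
    by (induction g rule: mpoly_induct)
      (simp_all add: distrib_left mult_single poly_eval_add monom_eval_add)
  with add show ?case by (simp add: distrib_right poly_eval_add)
qed simp

lemma poly_eval_Const [simp]: "poly_eval (Const c) \<gamma> = c"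
  by (simp add: Const_def)

lemma poly_eval_one [simp]: "poly_eval 1 \<gamma> = 1"
  by (simp flip: single_one)

lemma poly_eval_Var [simp]: "poly_eval (Var v) \<gamma> = \<gamma> $$ v"
  by (simp add: Var_def monom_eval_def)

interpretation poly_eval: comm_ring_hom "\<lambda>f. poly_eval f \<gamma>" for \<gamma>
  by unfold_locales (simp_all add: poly_eval_add poly_eval_mult)

lemma poly_ring_add: "f \<in> poly_ring r n \<Longrightarrow> g \<in> poly_ring r n \<Longrightarrow> f + g \<in> poly_ring r n"
  using keys_add[of f g] by (fastforce simp: poly_ring_def)

lemma poly_ring_mult:
  assumes "f \<in> poly_ring r n" "g \<in> poly_ring r n"
  shows "f * g \<in> poly_ring r n"
  unfolding poly_ring_def
proof (intro CollectI ballI)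
  fix m assume "m \<in> Poly_Mapping.keys (f * g)"
  then obtain a b where "m = a + b" "a \<in> Poly_Mapping.keys f" "b \<in> Poly_Mapping.keys g"
    using keys_mult[of f g] by blast
  then show "Poly_Mapping.keys m \<subseteq> {..<r} \<times> {..<n}"
    using keys_add[of a b] assms by (fastforce simp: poly_ring_def)
qed

lemma poly_ring_Const [simp]: "Const c \<in> poly_ring r n"
  by (simp add: poly_ring_def Const_def)

lemma poly_ring_0 [simp]: "0 \<in> poly_ring r n"
  by (simp add: poly_ring_def)

lemma poly_ring_1 [simp]: "1 \<in> poly_ring r n"
  by (simp add: poly_ring_def)

lemma poly_ring_neg_one_power: "(-1) ^ k \<in> poly_ring r n"
  by (induction k) (auto intro!: poly_ring_mult simp: poly_ring_def)

lemma poly_ring_Var: "i < r \<Longrightarrow> j < n \<Longrightarrow> Var (i, j) \<in> poly_ring r n"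
  by (simp add: poly_ring_def Var_def)

lemma poly_ring_sum: "(\<And>x. x \<in> A \<Longrightarrow> f x \<in> poly_ring r n) \<Longrightarrow> sum f A \<in> poly_ring r n"
  by (induction A rule: infinite_finite_induct) (auto intro: poly_ring_add)

lemma poly_ring_prod: "(\<And>x. x \<in> A \<Longrightarrow> f x \<in> poly_ring r n) \<Longrightarrow> prod f A \<in> poly_ring r n"
  by (induction A rule: infinite_finite_induct) (auto intro: poly_ring_mult)

lemma poly_ring_det:
  assumes "\<And>i j. i < dim_row A \<Longrightarrow> j < dim_col A \<Longrightarrow> A $$ (i, j) \<in> poly_ring r n"
  shows "det A \<in> poly_ring r n"
proof (cases "dim_row A = dim_col A")
  case True
  have "(signof p :: mpoly) \<in> poly_ring r n" for p :: "nat \<Rightarrow> nat"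
    using poly_ring_neg_one_power[of 1 r n] by (simp add: sign_def)
  then show ?thesis
    unfolding det_def using True assms
    by (auto intro!: poly_ring_sum poly_ring_mult poly_ring_prod simp: permutes_def permutes_in_image)
qed (simp add: det_def)

section \<open>Linear relations among the columns of a matrix\<close>

lemma underdetermined_system:
  fixes F :: "'t \<Rightarrow> 's \<Rightarrow> 'a :: field"
  assumes "finite S" "finite T" "card T < card S"
  obtains v where "\<exists>s \<in> S. v s \<noteq> 0" "\<And>t. t \<in> T \<Longrightarrow> (\<Sum>s \<in> S. F t s * v s) = 0"
proof -
  let ?d = "card S" and ?e = "card T"
  obtain g where g: "bij_betw g {..<?d} S"
    using ex_bij_betw_nat_finite[OF assms(1)] by (auto simp: atLeast0LessThan)
  obtain h where h: "bij_betw h {..<?e} T"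
    using ex_bij_betw_nat_finite[OF assms(2)] by (auto simp: atLeast0LessThan)
  \<comment> \<open>The coefficients, padded with zero rows to a singular square matrix.\<close>
  define A where "A = mat ?d ?d (\<lambda>(i, j). if i < ?e then F (h i) (g j) else 0)"
  have A: "A \<in> carrier_mat ?d ?d" by (simp add: A_def)
  have "det A = (\<Sum>j<?d. A $$ (?e, j) * cofactor A ?e j)"
    by (rule laplace_expansion_row[OF A assms(3)])
  also have "\<dots> = 0" using assms(3) by (auto simp: A_def intro!: sum.neutral)
  finally obtain w where w: "w \<in> carrier_vec ?d" "w \<noteq> 0\<^sub>v ?d" "A *\<^sub>v w = 0\<^sub>v ?d"
    using det_0_iff_vec_prod_zero_field[OF A] by blast
  define v where "v s = w $ (the_inv_into {..<?d} g s)" for s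
  have vg: "v (g j) = w $ j" if "j < ?d" for j
    unfolding v_def using g that by (simp add: the_inv_into_f_f bij_betw_def)
  show thesis
  proof
    from w obtain j where j: "j < ?d" "w $ j \<noteq> 0" by (metis carrier_vecD eq_vecI index_zero_vec)
    then have "v (g j) \<noteq> 0" "g j \<in> S" using vg g by (auto simp: bij_betw_def)
    then show "\<exists>s \<in> S. v s \<noteq> 0" by blast
    fix t assume "t \<in> T"
    then obtain i where i: "i < ?e" "t = h i" using h by (auto simp: bij_betw_def)
    have "(\<Sum>s \<in> S. F t s * v s) = (\<Sum>j<?d. F t (g j) * v (g j))"
      by (rule sum.reindex_bij_betw[OF g, symmetric])
    also have "\<dots> = (\<Sum>j<?d. A $$ (i, j) * w $ j)"
      using i assms(3) by (intro sum.cong) (auto simp: A_def vg)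
    also have "\<dots> = (A *\<^sub>v w) $ i"
      using i assms(3) A w(1) by (auto simp: scalar_prod_def atLeast0LessThan)
    finally show "(\<Sum>s \<in> S. F t s * v s) = 0" using w(3) i assms(3) by simp
  qed
qed

text \<open>
  A linear relation among the columns of \<open>\<gamma>\<close> with indices in \<open>A\<close>. The coefficients are indexed
  by all natural numbers and vanish outside \<open>A\<close>, so that relations on different sets can be
  combined without changing the range of summation.
\<close>

definition linear_relation :: "complex mat \<Rightarrow> nat set \<Rightarrow> (nat \<Rightarrow> complex) \<Rightarrow> bool" where
  "linear_relation \<gamma> A a \<longleftrightarrow> (\<forall>p. a p \<noteq> 0 \<longrightarrow> p \<in> A) \<and>
     (\<forall>i < dim_row \<gamma>. (\<Sum>p < dim_col \<gamma>. a p * \<gamma> $$ (i, p)) = 0)"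

lemma linear_relation_support: "linear_relation \<gamma> A a \<Longrightarrow> p \<notin> A \<Longrightarrow> a p = 0"
  by (auto simp: linear_relation_def)

lemma linear_relation_combine:
  assumes "linear_relation \<gamma> A a" "linear_relation \<gamma> B b"
    and "\<And>p. x * a p + y * b p \<noteq> 0 \<Longrightarrow> p \<in> D"
  shows "linear_relation \<gamma> D (\<lambda>p. x * a p + y * b p)"
  unfolding linear_relation_def
proof (intro conjI allI impI)
  fix i assume "i < dim_row \<gamma>"
  then have "x * (\<Sum>p < dim_col \<gamma>. a p * \<gamma> $$ (i, p)) + y * (\<Sum>p < dim_col \<gamma>. b p * \<gamma> $$ (i, p)) = 0"
    using assms(1,2) by (simp add: linear_relation_def)
  then show "(\<Sum>p < dim_col \<gamma>. (x * a p + y * b p) * \<gamma> $$ (i, p)) = 0"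
    by (simp add: algebra_simps sum.distrib sum_distrib_left)
qed (use assms(3) in auto)

lemma dependent_family_iff:
  assumes "A \<subseteq> {..<dim_col \<gamma>}"
  shows "dependent_family \<gamma> A \<longleftrightarrow> (\<exists>a p. linear_relation \<gamma> A a \<and> a p \<noteq> 0)"
proof -
  have sum_eq: "(\<Sum>p < dim_col \<gamma>. a p * \<gamma> $$ (i, p)) = (\<Sum>p \<in> A. b p * \<gamma> $$ (i, p))"
    if "\<And>p. p \<notin> A \<Longrightarrow> a p = 0" "\<And>p. p \<in> A \<Longrightarrow> a p = b p" for a b i
  proof -
    have "(\<Sum>p < dim_col \<gamma>. a p * \<gamma> $$ (i, p)) = (\<Sum>p \<in> A. a p * \<gamma> $$ (i, p))"
      using assms that by (intro sum.mono_neutral_right) auto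
    then show ?thesis using that by simp
  qed
  show ?thesis
  proof
    assume "dependent_family \<gamma> A"
    then obtain b p where b: "p \<in> A" "b p \<noteq> 0"
      "\<And>i. i < dim_row \<gamma> \<Longrightarrow> (\<Sum>p \<in> A. b p * \<gamma> $$ (i, p)) = 0"
      by (auto simp: dependent_family_def)
    define a where "a p = (if p \<in> A then b p else 0)" for p
    have "linear_relation \<gamma> A a"
      using b(3) sum_eq[of a b] by (auto simp: linear_relation_def a_def)
    moreover have "a p \<noteq> 0" using b by (simp add: a_def)
    ultimately show "\<exists>a p. linear_relation \<gamma> A a \<and> a p \<noteq> 0" by blast
  next
    assume "\<exists>a p. linear_relation \<gamma> A a \<and> a p \<noteq> 0"
    then obtain a p where "linear_relation \<gamma> A a" "a p \<noteq> 0" by blast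
    then show "dependent_family \<gamma> A"
      using sum_eq[of a a, OF linear_relation_support[of \<gamma> A a]]
      by (auto simp: dependent_family_def linear_relation_def intro!: exI[of _ a])
  qed
qed

lemma dependent_family_mono:
  assumes "dependent_family \<gamma> A" "A \<subseteq> A'" "A' \<subseteq> {..<dim_col \<gamma>}"
  shows "dependent_family \<gamma> A'"
proof -
  obtain a p where a: "linear_relation \<gamma> A a" "a p \<noteq> 0"
    using assms dependent_family_iff[of A \<gamma>] by auto
  then have "linear_relation \<gamma> A' a" using assms(2) by (auto simp: linear_relation_def)
  then show ?thesis using a(2) dependent_family_iff[OF assms(3)] by blast
qed

lemma dependent_family_of_card:
  assumes "finite A" "dim_row \<gamma> < card A"
  shows "dependent_family \<gamma> A"
proof -
  obtain v where "\<exists>p \<in> A. v p \<noteq> 0" "\<And>i. i \<in> {..<dim_row \<gamma>} \<Longrightarrow> (\<Sum>p \<in> A. \<gamma> $$ (i, p) * v p) = 0"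
    by (rule underdetermined_system[of A "{..<dim_row \<gamma>}" "\<lambda>i p. \<gamma> $$ (i, p)"])
      (use assms in auto)
  then show ?thesis
    unfolding dependent_family_def by (auto simp: mult.commute intro!: exI[of _ v])
qed

text \<open>
  The columns of the lifted matrix are \<open>\<gamma>\<^sub>p + z\<^sub>p q\<close>.
\<close>

lemma linear_relation_lift:
  assumes "\<gamma> \<in> carrier_mat r n"
  shows "linear_relation (lift \<gamma> q z) A b \<longleftrightarrow> (\<forall>p. b p \<noteq> 0 \<longrightarrow> p \<in> A) \<and>
    (\<forall>i<r. (\<Sum>p<n. b p * \<gamma> $$ (i, p)) + (\<Sum>p<n. b p * z $ p) * q $ i = 0)"
proof -
  have "(\<Sum>p<n. b p * lift \<gamma> q z $$ (i, p)) =
    (\<Sum>p<n. b p * \<gamma> $$ (i, p)) + (\<Sum>p<n. b p * z $ p) * q $ i" if "i < r" for i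
    using that assms by (simp add: lift_def algebra_simps sum.distrib sum_distrib_left)
  then show ?thesis using assms by (auto simp: linear_relation_def lift_def)
qed

lemma lift_carrier [simp]: "\<gamma> \<in> carrier_mat r n \<Longrightarrow> lift \<gamma> q z \<in> carrier_mat r n"
  by (simp add: lift_def)

lemma combination_in_span:
  fixes \<gamma> :: "complex mat"
  assumes "\<gamma> \<in> carrier_mat r n" "A \<subseteq> {..<n}" "q \<in> carrier_vec r"
    and supp: "\<And>p. a p \<noteq> 0 \<Longrightarrow> p \<in> A"
    and q: "\<And>i. i < r \<Longrightarrow> q $ i = (\<Sum>p<n. a p * \<gamma> $$ (i, p))"
  shows "q \<in> LinearCombinations.module.span class_ring (module_vec TYPE(complex) r) (col \<gamma> ` A)"
proof -
  interpret vec_space "TYPE(complex)" r .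
  have sub: "col \<gamma> ` A \<subseteq> carrier_vec r" using assms(1) by (auto simp: carrier_matD)
  interpret S: submodule class_ring "span (col \<gamma> ` A)" V
    by (rule span_is_submodule) (use sub in auto)
  have "vec r (\<lambda>i. \<Sum>p\<in>B. a p * \<gamma> $$ (i, p)) \<in> span (col \<gamma> ` A)" if "finite B" "B \<subseteq> A" for B
    using that
  proof (induction B rule: finite_induct)
    case empty
    have "vec r (\<lambda>i. \<Sum>p\<in>{}. a p * \<gamma> $$ (i, p)) = 0\<^sub>v r" by auto
    then show ?case using S.zero_closed by simp
  next
    case (insert p B)
    have p: "p < n" using insert.prems assms(2) by auto
    have eq: "vec r (\<lambda>i. \<Sum>p\<in>insert p B. a p * \<gamma> $$ (i, p)) =
      a p \<cdot>\<^sub>v col \<gamma> p + vec r (\<lambda>i. \<Sum>p\<in>B. a p * \<gamma> $$ (i, p))"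
      using insert.hyps assms(1) p by (intro eq_vecI) auto
    have "col \<gamma> p \<in> span (col \<gamma> ` A)" using insert.prems sub by (intro span_mem) auto
    then have "a p \<cdot>\<^sub>v col \<gamma> p \<in> span (col \<gamma> ` A)" using S.smult_closed[of "a p"] by simp
    then show ?case unfolding eq using S.m_closed insert by simp
  qed
  moreover have "q = vec r (\<lambda>i. \<Sum>p\<in>A. a p * \<gamma> $$ (i, p))"
  proof (rule eq_vecI)
    fix i assume i: "i < dim_vec (vec r (\<lambda>i. \<Sum>p\<in>A. a p * \<gamma> $$ (i, p)))"
    have "(\<Sum>p<n. a p * \<gamma> $$ (i, p)) = (\<Sum>p\<in>A. a p * \<gamma> $$ (i, p))"
      using assms(2) supp by (intro sum.mono_neutral_right) auto
    then show "q $ i = vec r (\<lambda>i. \<Sum>p\<in>A. a p * \<gamma> $$ (i, p)) $ i" using q i by simp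
  qed (use assms(3) in auto)
  ultimately show ?thesis using assms(2) finite_subset[of A "{..<n}"] by simp
qed

lemma functional_zero_on_span:
  fixes \<gamma> :: "complex mat"
  assumes "\<gamma> \<in> carrier_mat r n" "A \<subseteq> {..<n}"
    and u: "\<And>p. p \<in> A \<Longrightarrow> (\<Sum>i<r. u i * \<gamma> $$ (i, p)) = 0"
    and v: "v \<in> LinearCombinations.module.span class_ring (module_vec TYPE(complex) r) (col \<gamma> ` A)"
  shows "(\<Sum>i<r. u i * v $ i) = 0"
proof -
  interpret vec_space "TYPE(complex)" r .
  let ?K = "{v \<in> carrier_vec r. (\<Sum>i<r. u i * v $ i) = 0}"
  have "submodule class_ring ?K V"
  proof
    fix v w assume "v \<in> ?K" "w \<in> ?K"
    then show "v \<oplus>\<^bsub>V\<^esub> w \<in> ?K" by (auto simp: distrib_left sum.distrib)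
  next
    fix c :: complex and v assume "v \<in> ?K"
    moreover have "(\<Sum>i<r. u i * (c * v $ i)) = c * (\<Sum>i<r. u i * v $ i)"
      by (simp add: sum_distrib_left mult_ac)
    ultimately show "c \<odot>\<^bsub>V\<^esub> v \<in> ?K" by (auto simp: mult.left_commute)
  qed auto
  moreover have "col \<gamma> ` A \<subseteq> ?K" using assms by auto
  ultimately have "span (col \<gamma> ` A) \<subseteq> ?K" by (intro span_is_subset)
  then show ?thesis using v by auto
qed

section \<open>Rank, circuits and realizations\<close>

text \<open>
  A matroid of rank \<open>r\<close> on \<open>[n]\<close>.
\<close>

locale ranked_matroid =
  fixes M :: "nat matroid" and r n :: nat
  assumes matroid: "is_matroid M" and ground: "ground M = {..<n}" and rank: "matroid_rank M = r"
begin

lemma finite_indep: "finite (indep M)"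
  using matroid by (auto simp: is_matroid_def intro: finite_subset)

lemma indep_card_le_rank: "I \<in> indep M \<Longrightarrow> I \<subseteq> A \<Longrightarrow> card I \<le> rank_of M A"
  unfolding rank_of_def using finite_indep by (auto intro!: Max_ge)

lemma rank_attained:
  obtains I where "I \<in> indep M" "I \<subseteq> A" "card I = rank_of M A"
proof -
  have "{} \<in> indep M" using matroid by (simp add: is_matroid_def)
  then have "rank_of M A \<in> card ` {I \<in> indep M. I \<subseteq> A}"
    unfolding rank_of_def using finite_indep by (intro Max_in) auto
  then show thesis using that by auto
qed

lemma rank_mono: "A \<subseteq> B \<Longrightarrow> rank_of M A \<le> rank_of M B"
  by (metis indep_card_le_rank order_trans rank_attained)

lemma indep_finite: "I \<in> indep M \<Longrightarrow> finite I"
  using matroid by (auto simp: is_matroid_def intro: finite_subset)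

lemma dependent_contains_circuit:
  assumes "dependent_set M A"
  obtains C where "C \<subseteq> A" "circuit M C"
proof -
  have "finite A" using assms ground by (auto simp: dependent_set_def intro: finite_subset)
  then have "\<exists>C \<subseteq> A. circuit M C" using assms
  proof (induction rule: finite_psubset_induct)
    case (psubset A)
    show ?case
    proof (cases "circuit M A")
      case False
      then obtain A' where "A' \<subset> A" "dependent_set M A'"
        using psubset.prems by (auto simp: circuit_def)
      then show ?thesis using psubset.IH[of A'] by blast
    qed blast
  qed
  then show thesis using that by blast
qed

lemma circuit_ground: "circuit M C \<Longrightarrow> C \<subseteq> {..<n}"
  by (simp add: circuit_def dependent_set_def ground)

lemma circuit_finite: "circuit M C \<Longrightarrow> finite C"
  using circuit_ground finite_subset by blast

lemma circuit_nonempty: "circuit M C \<Longrightarrow> C \<noteq> {}"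
  using matroid by (auto simp: circuit_def dependent_set_def is_matroid_def)

lemma circuit_minus_indep: "circuit M C \<Longrightarrow> x \<in> C \<Longrightarrow> C - {x} \<in> indep M"
  unfolding circuit_def dependent_set_def by blast

lemma circuit_card_le:
  assumes "circuit M C" "C \<subseteq> A"
  shows "card C \<le> Suc (rank_of M A)"
proof -
  obtain x where x: "x \<in> C" using circuit_nonempty assms(1) by blast
  have "card (C - {x}) \<le> rank_of M A"
    using circuit_minus_indep[OF assms(1) x] assms(2) by (intro indep_card_le_rank) auto
  then show ?thesis using x by (simp add: card_Diff_singleton)
qed

lemma circuit_rank_less: "circuit M C \<Longrightarrow> rank_of M C < card C"
  by (metis circuit_def circuit_finite dependent_set_def psubsetI psubset_card_mono rank_attained)

lemma rank_closure_le:
  assumes "X \<subseteq> matroid_closure M A"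
  shows "rank_of M X \<le> rank_of M A"
proof (rule ccontr)
  assume "\<not> rank_of M X \<le> rank_of M A"
  moreover obtain J where J: "J \<in> indep M" "J \<subseteq> X" "card J = rank_of M X" by (rule rank_attained)
  moreover obtain I where I: "I \<in> indep M" "I \<subseteq> A" "card I = rank_of M A" by (rule rank_attained)
  ultimately have "card I < card J" by simp
  then obtain x where x: "x \<in> J - I" "insert x I \<in> indep M"
    using matroid I(1) J(1) unfolding is_matroid_def by blast
  have "card (insert x I) \<le> rank_of M (insert x A)"
    using x(2) I(2) by (intro indep_card_le_rank) auto
  moreover have "rank_of M (insert x A) = rank_of M A"
    using x(1) J(2) assms by (auto simp: matroid_closure_def)
  ultimately show False using x(1) I(1,3) indep_finite by simp
qed

lemma subset_closure: "A \<subseteq> {..<n} \<Longrightarrow> A \<subseteq> matroid_closure M A"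
  by (auto simp: matroid_closure_def ground insert_absorb)

lemma rank_le: "rank_of M N \<le> r" if "N \<subseteq> {..<n}"
  using rank_mono[OF that] rank ground by (simp add: matroid_rank_def)

lemma realization_carrier: "\<gamma> \<in> realizations r n M \<Longrightarrow> \<gamma> \<in> carrier_mat r n"
  by (simp add: realizations_def)

lemma dependent_set_iff_relation:
  assumes "\<gamma> \<in> realizations r n M" "A \<subseteq> {..<n}"
  shows "dependent_set M A \<longleftrightarrow> (\<exists>a p. linear_relation \<gamma> A a \<and> a p \<noteq> 0)"
  using assms dependent_family_iff[of A \<gamma>] by (auto simp: realizations_def)

lemma indep_relation_zero:
  assumes "\<gamma> \<in> realizations r n M" "I \<in> indep M" "linear_relation \<gamma> I a"
  shows "a p = 0"
proof -
  have "I \<subseteq> {..<n}" using matroid assms(2) ground by (auto simp: is_matroid_def)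
  then show ?thesis using dependent_set_iff_relation[OF assms(1)] assms by (auto simp: dependent_set_def)
qed

text \<open>
  All coefficients are nonzero, because a circuit is minimally dependent.
\<close>

lemma circuit_relation:
  assumes \<gamma>: "\<gamma> \<in> realizations r n M" and C: "circuit M C"
  obtains a where "linear_relation \<gamma> C a" "\<And>p. p \<in> C \<Longrightarrow> a p \<noteq> 0"
proof -
  obtain a p where a: "linear_relation \<gamma> C a" "a p \<noteq> 0"
    using dependent_set_iff_relation[OF \<gamma> circuit_ground[OF C]] C by (auto simp: circuit_def)
  have "a x \<noteq> 0" if "x \<in> C" for x
  proof
    assume "a x = 0"
    then have "linear_relation \<gamma> (C - {x}) a"
      using a(1) by (auto simp: linear_relation_def)
    then show False using indep_relation_zero[OF \<gamma> circuit_minus_indep[OF C that]] a(2) by blast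
  qed
  then show thesis using that a by blast
qed

section \<open>The solution space and its coordinates\<close>

text \<open>
  The space \<open>L\<^sub>\<gamma>\<close> for the circuits contained in \<open>N\<close>. Only the values of \<open>z\<close> on \<open>N\<close> are
  constrained. Circuits with \<open>r + 1\<close> elements are excluded, since \<open>r + 1\<close> vectors of \<open>\<complex>\<^sup>r\<close> are
  always dependent.
\<close>

definition lift_solutions :: "complex mat \<Rightarrow> nat set \<Rightarrow> (nat \<Rightarrow> complex) set" where
  "lift_solutions \<gamma> N = {z. \<forall>C a. circuit M C \<longrightarrow> C \<subseteq> N \<longrightarrow> card C \<le> r \<longrightarrow>
     linear_relation \<gamma> C a \<longrightarrow> (\<Sum>p<n. a p * z p) = 0}"

lemma lift_solutionsD:
  "z \<in> lift_solutions \<gamma> N \<Longrightarrow> circuit M C \<Longrightarrow> C \<subseteq> N \<Longrightarrow> card C \<le> r \<Longrightarrow> linear_relation \<gamma> C a \<Longrightarrow>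
    (\<Sum>p<n. a p * z p) = 0"
  unfolding lift_solutions_def by blast

lemma lift_solutions_cong:
  assumes "z \<in> lift_solutions \<gamma> N" "\<And>p. p < n \<Longrightarrow> z p = w p"
  shows "w \<in> lift_solutions \<gamma> N"
proof -
  have "(\<Sum>p<n. a p * w p) = (\<Sum>p<n. a p * z p)" for a using assms(2) by (intro sum.cong) auto
  then show ?thesis using assms(1) by (simp add: lift_solutions_def)
qed

lemma lift_solutions_linear:
  assumes "z \<in> lift_solutions \<gamma> N" "w \<in> lift_solutions \<gamma> N"
  shows "(\<lambda>p. x * z p + y * w p) \<in> lift_solutions \<gamma> N"
  unfolding lift_solutions_def
proof (intro CollectI allI impI)
  fix C a assume C: "circuit M C" "C \<subseteq> N" "card C \<le> r" "linear_relation \<gamma> C a"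
  have "(\<Sum>p<n. a p * (x * z p + y * w p)) = x * (\<Sum>p<n. a p * z p) + y * (\<Sum>p<n. a p * w p)"
    by (simp add: algebra_simps sum.distrib sum_distrib_left)
  then show "(\<Sum>p<n. a p * (x * z p + y * w p)) = 0"
    using lift_solutionsD[OF assms(1) C] lift_solutionsD[OF assms(2) C] by simp
qed

lemma lift_solutions_lincomb:
  assumes "\<And>s. s \<in> S \<Longrightarrow> z s \<in> lift_solutions \<gamma> N"
  shows "(\<lambda>p. \<Sum>s \<in> S. x s * z s p) \<in> lift_solutions \<gamma> N"
  unfolding lift_solutions_def
proof (intro CollectI allI impI)
  fix C a assume C: "circuit M C" "C \<subseteq> N" "card C \<le> r" "linear_relation \<gamma> C a"
  have "(\<Sum>p<n. a p * (\<Sum>s \<in> S. x s * z s p)) = (\<Sum>p<n. \<Sum>s \<in> S. x s * (a p * z s p))"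
    by (simp add: sum_distrib_left mult_ac)
  also have "\<dots> = (\<Sum>s \<in> S. x s * (\<Sum>p<n. a p * z s p))"
    by (subst sum.swap) (simp add: sum_distrib_left)
  also have "\<dots> = 0" using lift_solutionsD[OF assms C] by simp
  finally show "(\<Sum>p<n. a p * (\<Sum>s \<in> S. x s * z s p)) = 0" .
qed

text \<open>
  A circuit in a set of rank less than \<open>r\<close> has at most \<open>r\<close> elements. Subtracting multiples of
  the relations of such circuits reduces any relation on the set to zero.
\<close>

lemma low_rank_relation_killed:
  assumes \<gamma>: "\<gamma> \<in> realizations r n M" and z: "z \<in> lift_solutions \<gamma> N"
    and "A \<subseteq> N" "A \<subseteq> {..<n}" "rank_of M A < r" "linear_relation \<gamma> A a"
  shows "(\<Sum>p<n. a p * z p) = 0"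
proof -
  have "finite A" using assms finite_subset by blast
  then show ?thesis using assms(3-)
  proof (induction arbitrary: a rule: finite_psubset_induct)
    case (psubset A)
    show ?case
    proof (cases "\<forall>p. a p = 0")
      case False
      then have "dependent_set M A"
        using dependent_set_iff_relation[OF \<gamma>] psubset.prems by blast
      then obtain C where C: "C \<subseteq> A" "circuit M C" by (rule dependent_contains_circuit)
      obtain c where c: "linear_relation \<gamma> C c" "\<And>p. p \<in> C \<Longrightarrow> c p \<noteq> 0"
        using circuit_relation[OF \<gamma> C(2)] by blast
      have "card C \<le> r" using circuit_card_le[OF C(2,1)] psubset.prems(3) by simp
      then have c0: "(\<Sum>p<n. c p * z p) = 0"
        using lift_solutionsD[OF z C(2) _ _ c(1)] C(1) psubset.prems(1) by blast
      obtain x where x: "x \<in> C" using circuit_nonempty[OF C(2)] by blast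
      \<comment> \<open>The circuit relation is used to eliminate the point \<open>x\<close>.\<close>
      let ?b = "\<lambda>p. 1 * a p + (- a x / c x) * c p"
      have "linear_relation \<gamma> (A - {x}) ?b"
        by (rule linear_relation_combine[OF psubset.prems(4) c(1)])
          (use c(2)[OF x] C(1) linear_relation_support[OF psubset.prems(4)]
            linear_relation_support[OF c(1)] in \<open>force split: if_splits\<close>)
      moreover have "rank_of M (A - {x}) < r"
        using rank_mono[of "A - {x}" A] psubset.prems(3) by simp
      ultimately have "(\<Sum>p<n. ?b p * z p) = 0"
        using psubset.IH[of "A - {x}" ?b] psubset.prems x C(1) by blast
      moreover have "(\<Sum>p<n. ?b p * z p) = (\<Sum>p<n. a p * z p) - a x / c x * (\<Sum>p<n. c p * z p)"
        by (simp add: algebra_simps sum.distrib sum_subtractf sum_distrib_left)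
      ultimately show ?thesis using c0 by simp
    qed simp
  qed
qed

text \<open>
  The set \<open>B\<close> is a set of coordinates for the solutions on \<open>N\<close>, simultaneously for all
  realizations: a solution takes arbitrary values on \<open>B\<close>, and these determine its values on \<open>N\<close>.
\<close>

definition coordinate_set :: "nat set \<Rightarrow> nat set \<Rightarrow> bool" where
  "coordinate_set N B \<longleftrightarrow> B \<subseteq> N \<and> (\<forall>\<gamma> \<in> realizations r n M.
     (\<forall>f. \<exists>z \<in> lift_solutions \<gamma> N. \<forall>b \<in> B. z b = f b) \<and>
     (\<forall>z \<in> lift_solutions \<gamma> N. (\<forall>b \<in> B. z b = 0) \<longrightarrow> (\<forall>x \<in> N. z x = 0)))"

lemma lift_solutions_mono: "N \<subseteq> N' \<Longrightarrow> lift_solutions \<gamma> N' \<subseteq> lift_solutions \<gamma> N"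
  unfolding lift_solutions_def by blast

lemma lift_solutions_upd:
  assumes "z \<in> lift_solutions \<gamma> N" "p \<notin> N"
  shows "z(p := w) \<in> lift_solutions \<gamma> N"
  unfolding lift_solutions_def
proof (intro CollectI allI impI)
  fix C a assume C: "circuit M C" "C \<subseteq> N" "card C \<le> r" "linear_relation \<gamma> C a"
  then have "a p = 0" using assms(2) linear_relation_support by blast
  then have "(\<Sum>q<n. a q * (z(p := w)) q) = (\<Sum>q<n. a q * z q)" by (intro sum.cong) auto
  then show "(\<Sum>q<n. a q * (z(p := w)) q) = 0" using lift_solutionsD[OF assms(1) C] by simp
qed

text \<open>
  Adding one point \<open>p\<close>. The hypothesis on pairs of small circuits through \<open>p\<close> ensures that they
  impose the same value at \<open>p\<close>.
\<close>

lemma coordinate_set_extend: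
  assumes B: "coordinate_set N B" and p: "p \<notin> N" and N: "insert p N \<subseteq> {..<n}"
    and low: "\<And>C D. circuit M C \<Longrightarrow> circuit M D \<Longrightarrow> C \<union> D \<subseteq> insert p N \<Longrightarrow> p \<in> C \<Longrightarrow> p \<in> D \<Longrightarrow>
      card C \<le> r \<Longrightarrow> card D \<le> r \<Longrightarrow> rank_of M (C \<union> D) < r"
  shows "\<exists>B'. coordinate_set (insert p N) B'"
proof (cases "\<exists>C. circuit M C \<and> C \<subseteq> insert p N \<and> p \<in> C \<and> card C \<le> r")
  case False
  then have sol_iff: "lift_solutions \<gamma> (insert p N) = lift_solutions \<gamma> N" for \<gamma>
    unfolding lift_solutions_def by (auto; metis subset_insert)
  have "coordinate_set (insert p N) (insert p B)"
    unfolding coordinate_set_def sol_iff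
  proof (intro conjI ballI allI impI)
    show "insert p B \<subseteq> insert p N" using B by (auto simp: coordinate_set_def)
  next
    fix \<gamma> f assume \<gamma>: "\<gamma> \<in> realizations r n M"
    then obtain z where z: "z \<in> lift_solutions \<gamma> N" "\<forall>b \<in> B. z b = f b"
      using B unfolding coordinate_set_def by blast
    then show "\<exists>z \<in> lift_solutions \<gamma> N. \<forall>b \<in> insert p B. z b = f b"
      by (intro bexI[of _ "z(p := f p)"] lift_solutions_upd p) auto
  next
    fix \<gamma> z x assume "\<gamma> \<in> realizations r n M" "z \<in> lift_solutions \<gamma> N"
      "\<forall>b \<in> insert p B. z b = 0" "x \<in> insert p N"
    then show "z x = 0" using B unfolding coordinate_set_def by auto
  qed
  then show ?thesis by blast
next
  case True
  then obtain C where C: "circuit M C" "C \<subseteq> insert p N" "p \<in> C" "card C \<le> r" by blast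
  have pn: "p < n" using N by auto
  have "coordinate_set (insert p N) B"
    unfolding coordinate_set_def
  proof (intro conjI ballI allI impI)
    show "B \<subseteq> insert p N" using B by (auto simp: coordinate_set_def)
  next
    fix \<gamma> f assume \<gamma>: "\<gamma> \<in> realizations r n M"
    then obtain z where z: "z \<in> lift_solutions \<gamma> N" "\<forall>b \<in> B. z b = f b"
      using B unfolding coordinate_set_def by blast
    obtain c where c: "linear_relation \<gamma> C c" "\<And>x. x \<in> C \<Longrightarrow> c x \<noteq> 0"
      using circuit_relation[OF \<gamma> C(1)] by blast
    \<comment> \<open>This value at \<open>p\<close> makes the relation \<open>c\<close> annihilate \<open>w\<close>.\<close>
    define w where "w = z(p := z p - (\<Sum>q<n. c q * z q) / c p)"
    have pair_w: "(\<Sum>q<n. a q * w q) = (\<Sum>q<n. a q * z q) - a p * (\<Sum>q<n. c q * z q) / c p" for a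
    proof -
      have "(\<Sum>q<n. a q * w q) =
        (\<Sum>q<n. a q * z q - (if q = p then a p * (\<Sum>q<n. c q * z q) / c p else 0))"
        unfolding w_def by (intro sum.cong) (auto simp: algebra_simps)
      then show ?thesis using pn by (simp add: sum_subtractf)
    qed
    have "w \<in> lift_solutions \<gamma> (insert p N)"
      unfolding lift_solutions_def
    proof (intro CollectI allI impI)
      fix D d assume D: "circuit M D" "D \<subseteq> insert p N" "card D \<le> r" "linear_relation \<gamma> D d"
      show "(\<Sum>q<n. d q * w q) = 0"
      proof (cases "p \<in> D")
        case False
        then have "d p = 0" "D \<subseteq> N" using D linear_relation_support by blast+
        then show ?thesis using lift_solutionsD[OF z(1) D(1) _ D(3,4)] pair_w[of d] by simp
      next
        case True
        \<comment> \<open>Eliminating \<open>p\<close> from the relations \<open>c\<close> and \<open>d\<close>.\<close>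
        let ?g = "\<lambda>q. 1 * d q + (- d p / c p) * c q"
        have "linear_relation \<gamma> (C \<union> D - {p}) ?g"
          by (rule linear_relation_combine[OF D(4) c(1)])
            (use c(2)[OF C(3)] linear_relation_support[OF D(4)]
            linear_relation_support[OF c(1)] in \<open>force split: if_splits\<close>)
        moreover have "rank_of M (C \<union> D - {p}) < r"
          using low[of C D] C D True rank_mono[of "C \<union> D - {p}" "C \<union> D"] by force
        ultimately have "(\<Sum>q<n. ?g q * z q) = 0"
          using C(2) D(2) N by (intro low_rank_relation_killed[OF \<gamma> z(1)]) auto
        moreover have "(\<Sum>q<n. ?g q * z q) = (\<Sum>q<n. d q * z q) - d p / c p * (\<Sum>q<n. c q * z q)"
          by (simp add: algebra_simps sum.distrib sum_subtractf sum_distrib_left)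
        ultimately show ?thesis by (simp add: pair_w)
      qed
    qed
    moreover have "\<forall>b \<in> B. w b = f b"
      using z(2) p B by (auto simp: w_def coordinate_set_def)
    ultimately show "\<exists>z \<in> lift_solutions \<gamma> (insert p N). \<forall>b \<in> B. z b = f b" by blast
  next
    fix \<gamma> z x assume \<gamma>: "\<gamma> \<in> realizations r n M" and z: "z \<in> lift_solutions \<gamma> (insert p N)"
      and zB: "\<forall>b \<in> B. z b = 0" and x: "x \<in> insert p N"
    have zN: "\<forall>x \<in> N. z x = 0"
      using B \<gamma> z zB lift_solutions_mono[of N "insert p N" \<gamma>] unfolding coordinate_set_def by blast
    obtain c where c: "linear_relation \<gamma> C c" "\<And>x. x \<in> C \<Longrightarrow> c x \<noteq> 0"
      using circuit_relation[OF \<gamma> C(1)] by blast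
    have "(\<Sum>q<n. c q * z q) = (\<Sum>q<n. if q = p then c p * z p else 0)"
      using zN C(2) linear_relation_support[OF c(1)] by (intro sum.cong refl) (metis insertE mult_eq_0_iff subsetD)
    then have "c p * z p = 0"
      using lift_solutionsD[OF z C(1,2,4) c(1)] pn by simp
    then show "z x = 0" using c(2)[OF C(3)] zN x by auto
  qed
  then show ?thesis by blast
qed

lemma coordinate_set_Un:
  assumes "coordinate_set N B" "N \<union> D \<subseteq> {..<n}" "N \<inter> D = {}"
    and low: "\<And>p C C'. p \<in> D \<Longrightarrow> circuit M C \<Longrightarrow> circuit M C' \<Longrightarrow> C \<union> C' \<subseteq> N \<union> D \<Longrightarrow>
      p \<in> C \<Longrightarrow> p \<in> C' \<Longrightarrow> card C \<le> r \<Longrightarrow> card C' \<le> r \<Longrightarrow> rank_of M (C \<union> C') < r"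
  shows "\<exists>B'. coordinate_set (N \<union> D) B'"
proof -
  have "finite D" using assms(2) finite_subset[of D "{..<n}"] by auto
  then show ?thesis using assms(2-)
  proof (induction D rule: finite_induct)
    case empty
    then show ?case using assms(1) by auto
  next
    case (insert p D)
    have "\<exists>B'. coordinate_set (N \<union> D) B'"
    proof (rule insert.IH)
      show "N \<union> D \<subseteq> {..<n}" "N \<inter> D = {}" using insert.prems(1,2) by auto
      fix p' C C'
      assume "p' \<in> D" "circuit M C" "circuit M C'" "C \<union> C' \<subseteq> N \<union> D" "p' \<in> C" "p' \<in> C'"
        "card C \<le> r" "card C' \<le> r"
      then show "rank_of M (C \<union> C') < r" by (intro insert.prems(3)[of p']) auto
    qed
    then obtain B' where B': "coordinate_set (N \<union> D) B'" by blast
    have "\<exists>B'. coordinate_set (insert p (N \<union> D)) B'"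
      by (rule coordinate_set_extend[OF B']) (use insert.prems insert.hyps in auto)
    then show ?case by simp
  qed
qed

lemma restrict_dependent:
  "N \<subseteq> {..<n} \<Longrightarrow>
    dependent_set (matroid_restrict M N) A \<longleftrightarrow> A \<subseteq> N \<and> dependent_set M A"
  by (auto simp: dependent_set_def matroid_restrict_def ground)

lemma restrict_circuit:
  "N \<subseteq> {..<n} \<Longrightarrow> circuit (matroid_restrict M N) C \<longleftrightarrow> C \<subseteq> N \<and> circuit M C"
  unfolding circuit_def using restrict_dependent[of N] by (metis psubset_imp_subset subset_trans)

lemma restrict_rank: "A \<subseteq> N \<Longrightarrow> rank_of (matroid_restrict M N) A = rank_of M A"
proof -
  assume "A \<subseteq> N"
  then have "{I \<in> indep (matroid_restrict M N). I \<subseteq> A} = {I \<in> indep M. I \<subseteq> A}"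
    by (auto simp: matroid_restrict_def)
  then show ?thesis by (simp add: rank_of_def)
qed

lemma restrict_matroid_rank: "matroid_rank (matroid_restrict M N) = rank_of M N"
  unfolding matroid_rank_def using restrict_rank[of N N] by (simp add: matroid_restrict_def)

lemma restrict_closure:
  "A \<subseteq> N \<Longrightarrow> N \<subseteq> {..<n} \<Longrightarrow> matroid_closure (matroid_restrict M N) A = matroid_closure M A \<inter> N"
  using restrict_rank[of A N] restrict_rank[of "insert x A" N for x]
  by (fastforce simp: matroid_closure_def ground matroid_restrict_def)

text \<open>
  If \<open>N\<close> has rank \<open>r\<close>, then the small circuits of \<open>M|N\<close> are those of \<open>M\<close> contained in \<open>N\<close>,
  and two of them through a point that lies in at most one subspace of \<open>M|N\<close> have the same closure,
  of rank less than \<open>r\<close>. If \<open>N\<close> has smaller rank, then \<open>M|N\<close> may have fewer small circuits than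
  that, but the rank of \<open>N\<close> itself is a sufficient bound.
\<close>

lemma low_rank_of_single_point:
  assumes N: "N \<subseteq> {..<n}" and p: "p \<in> N" "p \<notin> multi_points (matroid_restrict M N)"
    and C: "circuit M C" "C \<subseteq> N" "p \<in> C" "card C \<le> r"
    and D: "circuit M D" "D \<subseteq> N" "p \<in> D" "card D \<le> r"
  shows "rank_of M (C \<union> D) < r"
proof (cases "rank_of M N < r")
  case True
  then show ?thesis using rank_mono[of "C \<union> D" N] C(2) D(2) by simp
next
  case False
  let ?R = "matroid_restrict M N"
  have "rank_of M N = r" using False rank_le[OF N] by simp
  then have small: "C \<in> small_circuits ?R" "D \<in> small_circuits ?R"
    using C D N by (auto simp: small_circuits_def restrict_circuit restrict_matroid_rank)
  have at: "closure_equiv ?R `` {X} \<in> subspaces_at ?R p" if "X \<in> small_circuits ?R" "p \<in> X" for X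
    using that by (auto simp: subspaces_at_def subspaces_def closure_equiv_def quotient_def)
  have "small_circuits ?R \<subseteq> Pow N"
    using N by (auto simp: small_circuits_def restrict_circuit)
  then have "closure_equiv ?R `` {X} \<subseteq> Pow N" for X
    by (auto simp: closure_equiv_def)
  then have "subspaces_at ?R p \<subseteq> Pow (Pow N)"
    unfolding subspaces_at_def subspaces_def quotient_def by blast
  then have "finite (subspaces_at ?R p)" using N by (meson finite_Pow_iff finite_lessThan finite_subset)
  moreover have "card (subspaces_at ?R p) \<le> 1"
    using p by (auto simp: multi_points_def matroid_restrict_def)
  ultimately have "closure_equiv ?R `` {C} = closure_equiv ?R `` {D}"
    using at[OF small(1) C(3)] at[OF small(2) D(3)] by (metis One_nat_def card_le_Suc0_iff_eq)
  then have "matroid_closure ?R C = matroid_closure ?R D"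
    using small by (auto simp: closure_equiv_def)
  then have "D \<subseteq> matroid_closure M C"
    using restrict_closure[OF C(2) N] restrict_closure[OF D(2) N] subset_closure[OF circuit_ground[OF D(1)]] D(2)
    by blast
  then have "rank_of M (C \<union> D) \<le> rank_of M C"
    using subset_closure[OF circuit_ground[OF C(1)]] by (intro rank_closure_le) auto
  then show ?thesis using circuit_rank_less[OF C(1)] C(4) by simp
qed

lemma nilpotent_chain_restrict:
  "ground (nilpotent_chain M j) \<subseteq> {..<n} \<and>
   nilpotent_chain M j = matroid_restrict M (ground (nilpotent_chain M j))"
proof (induction j)
  case 0
  have "{I \<in> indep M. I \<subseteq> {..<n}} = indep M" using matroid ground by (auto simp: is_matroid_def)
  then show ?case using ground by (auto simp: matroid_restrict_def intro: matroid.equality)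
next
  case (Suc j)
  let ?N = "ground (nilpotent_chain M j)" and ?P = "multi_points (nilpotent_chain M j)"
  have P: "?P \<subseteq> ?N" by (auto simp: multi_points_def)
  moreover have "matroid_restrict (matroid_restrict M ?N) ?P = matroid_restrict M ?P"
    using P by (auto simp: matroid_restrict_def)
  ultimately show ?case using Suc by (metis nilpotent_chain.simps(2) matroid.select_convs(1) matroid_restrict_def subset_trans)
qed

lemma nilpotent_coordinate_set:
  assumes "nilpotent_matroid M"
  obtains B where "coordinate_set {..<n} B"
proof -
  let ?G = "\<lambda>j. ground (nilpotent_chain M j)"
  obtain J where J: "?G J = {}" using assms by (auto simp: nilpotent_matroid_def)
  have "\<exists>B. coordinate_set (?G 0) B"
  \<comment> \<open>Downwards induction from the empty member of the chain.\<close>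
  proof (rule inc_induct[of 0 J])
    have "(\<lambda>_. 0) \<in> lift_solutions \<gamma> {}" for \<gamma> by (simp add: lift_solutions_def)
    then have "coordinate_set {} {}" unfolding coordinate_set_def by blast
    then show "\<exists>B. coordinate_set (?G J) B" using J by auto
  next
    fix j assume "\<exists>B. coordinate_set (?G (Suc j)) B"
    then obtain B where B: "coordinate_set (?G (Suc j)) B" by blast
    define N where "N = ?G j"
    have N: "N \<subseteq> {..<n}" and R: "nilpotent_chain M j = matroid_restrict M N"
      using nilpotent_chain_restrict[of j] by (auto simp: N_def)
    have P: "?G (Suc j) = multi_points (matroid_restrict M N)"
      by (simp add: R matroid_restrict_def)
    have PN: "multi_points (matroid_restrict M N) \<subseteq> N"
      by (auto simp: multi_points_def matroid_restrict_def)
    have "\<exists>B'. coordinate_set (?G (Suc j) \<union> (N - ?G (Suc j))) B'"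
      by (rule coordinate_set_Un[OF B]) (use N P PN low_rank_of_single_point[OF N] in \<open>auto simp: Un_absorb1\<close>)
    moreover have "?G (Suc j) \<union> (N - ?G (Suc j)) = ?G j" using P PN by (auto simp: N_def)
    ultimately show "\<exists>B. coordinate_set (?G j) B" by simp
  qed simp
  then show thesis using that ground by auto
qed

text \<open>
  A linear functional \<open>u\<close> that vanishes on a basis of \<open>A\<close>, which has less than \<open>r\<close> elements,
  vanishes on \<open>\<gamma>\<^sub>p\<close> for all \<open>p \<in> A\<close>.
\<close>

lemma low_rank_functional:
  assumes \<gamma>: "\<gamma> \<in> realizations r n M" and A: "A \<subseteq> {..<n}" "rank_of M A < r"
  obtains u where "\<exists>i<r. u i \<noteq> 0" "\<And>p. p \<in> A \<Longrightarrow> (\<Sum>i<r. u i * \<gamma> $$ (i, p)) = 0"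
proof -
  obtain I where I: "I \<in> indep M" "I \<subseteq> A" "card I = rank_of M A" by (rule rank_attained)
  obtain u where u: "\<exists>i \<in> {..<r}. u i \<noteq> 0"
    "\<And>p. p \<in> I \<Longrightarrow> (\<Sum>i \<in> {..<r}. \<gamma> $$ (i, p) * u i) = 0"
    by (rule underdetermined_system[of "{..<r}" I "\<lambda>p i. \<gamma> $$ (i, p)"])
      (use I A indep_finite in auto)
  have "(\<Sum>i<r. u i * \<gamma> $$ (i, p)) = 0" if p: "p \<in> A" for p
  proof (cases "p \<in> I")
    case True
    then show ?thesis using u(2) by (simp add: mult.commute)
  next
    case False
    have "insert p I \<notin> indep M"
      using indep_card_le_rank[of "insert p I" A] I p False indep_finite[OF I(1)] by auto
    then have "dependent_set M (insert p I)" using I A p by (auto simp: dependent_set_def ground)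
    then obtain a x where a: "linear_relation \<gamma> (insert p I) a" "a x \<noteq> 0"
      using dependent_set_iff_relation[OF \<gamma>, of "insert p I"] I A p by blast
    have ap: "a p \<noteq> 0"
    proof
      assume "a p = 0"
      then have "linear_relation \<gamma> I a" using a(1) by (auto simp: linear_relation_def)
      then show False using indep_relation_zero[OF \<gamma> I(1)] a(2) by blast
    qed
    have "(\<Sum>q<n. a q * (\<Sum>i<r. u i * \<gamma> $$ (i, q))) = (\<Sum>i<r. u i * (\<Sum>q<n. a q * \<gamma> $$ (i, q)))"
      by (simp add: sum_distrib_left mult_ac) (rule sum.swap)
    also have "\<dots> = 0"
      using a(1) realization_carrier[OF \<gamma>] by (auto simp: linear_relation_def)
    finally have "(\<Sum>q<n. a q * (\<Sum>i<r. u i * \<gamma> $$ (i, q))) = 0" .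
    moreover have "(\<Sum>q<n. a q * (\<Sum>i<r. u i * \<gamma> $$ (i, q))) =
      (\<Sum>q<n. if q = p then a p * (\<Sum>i<r. u i * \<gamma> $$ (i, p)) else 0)"
      using u(2) linear_relation_support[OF a(1)]
      by (intro sum.cong) (auto simp: mult.commute[of _ "u _"])
    ultimately show ?thesis using ap A p by auto
  qed
  then show thesis using that u(1) by auto
qed

section \<open>The dimension of the lift space\<close>

lemma circuit_relation_unique:
  assumes \<gamma>: "\<gamma> \<in> realizations r n M" and C: "circuit M C"
    and a: "linear_relation \<gamma> C a" and b: "linear_relation \<gamma> C b" "b x \<noteq> 0"
  shows "a p = a x / b x * b p"
proof -
  have x: "x \<in> C" using b linear_relation_support by blast
  have "linear_relation \<gamma> (C - {x}) (\<lambda>p. 1 * a p + (- a x / b x) * b p)"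
    by (rule linear_relation_combine[OF a b(1)])
      (use b(2) linear_relation_support[OF a] linear_relation_support[OF b(1)] in \<open>force split: if_splits\<close>)
  from indep_relation_zero[OF \<gamma> circuit_minus_indep[OF C x] this, of p] show ?thesis by simp
qed

lemma subspace_points:
  assumes "l \<in> subspaces M"
  shows "\<Union>l \<subseteq> {..<n}" "rank_of M (\<Union>l) < r"
proof -
  obtain C where C: "C \<in> small_circuits M" "l = closure_equiv M `` {C}"
    using assms by (auto simp: subspaces_def quotient_def)
  have D: "D \<subseteq> {..<n} \<and> D \<subseteq> matroid_closure M C" if "D \<in> l" for D
  proof -
    have "circuit M D" "matroid_closure M D = matroid_closure M C"
      using that C(2) by (auto simp: closure_equiv_def small_circuits_def)
    then show ?thesis using circuit_ground subset_closure by metis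
  qed
  then show "\<Union>l \<subseteq> {..<n}" by blast
  have "rank_of M (\<Union>l) \<le> rank_of M C" using D by (intro rank_closure_le) blast
  also have "\<dots> < card C" using C(1) by (intro circuit_rank_less) (simp add: small_circuits_def)
  finally show "rank_of M (\<Union>l) < r" using C(1) rank by (simp add: small_circuits_def)
qed

lemma lift_space_iff:
  assumes \<gamma>: "\<gamma> \<in> realizations r n M" and q: "outside r M q \<gamma>" and z: "z \<in> carrier_vec n"
  shows "z \<in> lift_space r n M q \<gamma> \<longleftrightarrow> (\<lambda>p. z $ p) \<in> lift_solutions \<gamma> {..<n}"
proof
  note g = realization_carrier[OF \<gamma>]
  let ?L = "lift \<gamma> q z"
  have dims: "dim_row ?L = r" "dim_col ?L = n" using g by (auto simp: lift_def)
  {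
    assume sol: "(\<lambda>p. z $ p) \<in> lift_solutions \<gamma> {..<n}"
    have "dependent_family ?L A" if A: "dependent_set M A" for A
    proof -
      obtain C where C: "C \<subseteq> A" "circuit M C" using dependent_contains_circuit[OF A] .
      have "dependent_family ?L C"
      proof (cases "card C \<le> r")
        case True
        obtain c where c: "linear_relation \<gamma> C c" "\<And>x. x \<in> C \<Longrightarrow> c x \<noteq> 0"
          using circuit_relation[OF \<gamma> C(2)] by blast
        have "(\<Sum>p<n. c p * z $ p) = 0"
          using lift_solutionsD[OF sol C(2) circuit_ground[OF C(2)] True c(1)] .
        then have "linear_relation ?L C c"
          using c(1) g unfolding linear_relation_lift[OF g] by (auto simp: linear_relation_def)
        then show ?thesis
          using c(2) circuit_nonempty[OF C(2)] circuit_ground[OF C(2)] dims dependent_family_iff[of C ?L] by blast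
      next
        case False
        then show ?thesis using dims circuit_finite[OF C(2)] by (intro dependent_family_of_card) auto
      qed
      then show ?thesis
        using dependent_family_mono[OF _ C(1)] A ground dims by (auto simp: dependent_set_def)
    qed
    then show "z \<in> lift_space r n M q \<gamma>" using z g by (simp add: lift_space_def circuit_variety_def)
  }
  assume mem: "z \<in> lift_space r n M q \<gamma>"
  show "(\<lambda>p. z $ p) \<in> lift_solutions \<gamma> {..<n}"
    unfolding lift_solutions_def
  proof (intro CollectI allI impI)
    fix C a assume C: "circuit M C" "C \<subseteq> {..<n}" "card C \<le> r" and a: "linear_relation \<gamma> C a"
    have "dependent_family ?L C"
      using mem C(1) by (auto simp: lift_space_def circuit_variety_def circuit_def)
    then obtain b x where b: "linear_relation ?L C b" "b x \<noteq> 0"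
      using dependent_family_iff[of C ?L] C(2) dims by auto
    define s where "s = (\<Sum>p<n. b p * z $ p)"
    have bs: "(\<Sum>p<n. b p * \<gamma> $$ (i, p)) + s * q $ i = 0" if "i < r" for i
      using b(1) that by (simp add: linear_relation_lift[OF g] s_def)
    \<comment> \<open>Otherwise \<open>q\<close> is a combination of the columns in \<open>C\<close>, against the choice of \<open>q\<close>.\<close>
    have s0: "s = 0"
    proof (rule ccontr)
      assume s: "s \<noteq> 0"
      define l where "l = closure_equiv M `` {C}"
      have Cs: "C \<in> small_circuits M" using C rank by (simp add: small_circuits_def)
      then have l: "l \<in> subspaces M" "C \<in> l"
        by (auto simp: subspaces_def l_def quotient_def closure_equiv_def)
      have "q \<in> LinearCombinations.module.span class_ring (module_vec TYPE(complex) r) (col \<gamma> ` \<Union>l)"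
      proof (rule combination_in_span[OF g, where a = "\<lambda>p. - b p / s"])
        fix i assume "i < r"
        have "(\<Sum>p<n. - b p / s * \<gamma> $$ (i, p)) = - (\<Sum>p<n. b p * \<gamma> $$ (i, p)) / s"
          by (simp add: sum_divide_distrib sum_negf)
        also have "\<dots> = q $ i" using bs[OF \<open>i < r\<close>] s by (simp add: field_simps add_eq_0_iff)
        finally show "q $ i = (\<Sum>p<n. - b p / s * \<gamma> $$ (i, p))" by simp
      qed (use subspace_points[OF l(1)] q l linear_relation_support[OF b(1)] in \<open>auto simp: outside_def\<close>)
      then show False using q l(1) by (auto simp: outside_def)
    qed
    then have bg: "linear_relation \<gamma> C b"
      using b(1) bs g by (auto simp: linear_relation_def)
    have "a p * z $ p = a x / b x * (b p * z $ p)" for p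
      using circuit_relation_unique[OF \<gamma> C(1) a bg b(2), of p] by (metis mult.assoc)
    then have "(\<Sum>p<n. a p * z $ p) = a x / b x * s"
      unfolding s_def sum_distrib_left by (intro sum.cong) auto
    then show "(\<Sum>p<n. a p * z $ p) = 0" using s0 by simp
  qed
qed

lemma outside_exists:
  assumes \<gamma>: "\<gamma> \<in> realizations r n M"
  obtains q where "outside r M q \<gamma>"
proof -
  note g = realization_carrier[OF \<gamma>]
  have "\<exists>u. (\<exists>i<r. u i \<noteq> 0) \<and> (\<forall>p \<in> \<Union>l. (\<Sum>i<r. u i * \<gamma> $$ (i, p)) = 0)"
    if "l \<in> subspaces M" for l
    using low_rank_functional[OF \<gamma> subspace_points[OF that]] by metis
  then obtain U where U: "\<And>l. l \<in> subspaces M \<Longrightarrow> \<exists>i<r. U l i \<noteq> 0"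
    "\<And>l p. l \<in> subspaces M \<Longrightarrow> p \<in> \<Union>l \<Longrightarrow> (\<Sum>i<r. U l i * \<gamma> $$ (i, p)) = 0"
    by metis
  \<comment> \<open>The value of \<open>U l\<close> at the point \<open>(1, t, \<dots>, t\<^sup>r\<^sup>-\<^sup>1)\<close> of the moment curve, as a polynomial in \<open>t\<close>.\<close>
  define P where "P l = (\<Sum>i<r. monom (U l i) i)" for l
  have "P l \<noteq> 0" if l: "l \<in> subspaces M" for l
  proof -
    obtain i where "i < r" "U l i \<noteq> 0" using U(1)[OF l] by blast
    moreover have "coeff (P l) i = U l i" using \<open>i < r\<close> by (simp add: P_def coeff_sum)
    ultimately show ?thesis by auto
  qed
  then have "finite (\<Union>l \<in> subspaces M. {t. poly (P l) t = 0})"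
  proof (intro finite_UN_I poly_roots_finite)
    have "subspaces M \<subseteq> Pow (Pow {..<n})" using subspace_points(1) by blast
    then show "finite (subspaces M)" by (rule finite_subset) simp
  qed auto
  then obtain t where t: "t \<notin> (\<Union>l \<in> subspaces M. {t. poly (P l) t = 0})"
    using infinite_UNIV_char_0 ex_new_if_finite by blast
  define q where "q = vec r (\<lambda>i. t ^ i)"
  have "outside r M q \<gamma>"
    unfolding outside_def
  proof (intro conjI ballI notI)
    show "q \<in> carrier_vec r" by (simp add: q_def)
    fix l assume l: "l \<in> subspaces M"
      and q: "q \<in> LinearCombinations.module.span class_ring (module_vec TYPE(complex) r) (col \<gamma> ` \<Union>l)"
    have "poly (P l) t = (\<Sum>i<r. U l i * q $ i)"
      by (simp add: P_def q_def poly_sum poly_monom)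
    also have "\<dots> = 0"
      by (rule functional_zero_on_span[OF g subspace_points(1)[OF l] _ q]) (use U(2)[OF l] in auto)
    finally show False using t l by auto
  qed
  then show thesis using that by blast
qed

lemma coordinate_set_unique:
  assumes "coordinate_set N B" "\<gamma> \<in> realizations r n M"
    and "z \<in> lift_solutions \<gamma> N" "\<And>b. b \<in> B \<Longrightarrow> z b = 0" "x \<in> N"
  shows "z x = 0"
  using assms unfolding coordinate_set_def by blast

text \<open>
  The solutions dual to the coordinates in \<open>B\<close>, for an enumeration \<open>g\<close> of \<open>B\<close>.
\<close>

lemma coordinate_basis:
  assumes B: "coordinate_set {..<n} B" and \<gamma>: "\<gamma> \<in> realizations r n M"
  obtains g e where "bij_betw g {..<card B} B" "\<And>j. e j \<in> lift_solutions \<gamma> {..<n}"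
    "\<And>i j. i < card B \<Longrightarrow> j < card B \<Longrightarrow> e j (g i) = (if i = j then 1 else 0)"
proof -
  have Bn: "B \<subseteq> {..<n}" using B by (simp add: coordinate_set_def)
  then obtain g where g: "bij_betw g {..<card B} B"
    using ex_bij_betw_nat_finite finite_subset by (metis atLeast0LessThan finite_lessThan)
  have ext: "\<exists>z \<in> lift_solutions \<gamma> {..<n}. \<forall>b \<in> B. z b = f b" for f
    using B \<gamma> unfolding coordinate_set_def by blast
  have "\<exists>z. z \<in> lift_solutions \<gamma> {..<n} \<and> (\<forall>b \<in> B. z b = (if b = g j then 1 else 0))" for j
    using ext[of "\<lambda>b. if b = g j then 1 else 0"] by blast
  then obtain e where "\<And>j. e j \<in> lift_solutions \<gamma> {..<n}"
    "\<And>j b. b \<in> B \<Longrightarrow> e j b = (if b = g j then 1 else 0)" by metis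
  moreover have "g i \<in> B" "g i = g j \<longleftrightarrow> i = j" if "i < card B" "j < card B" for i j
    using g that by (auto simp: bij_betw_def inj_on_def)
  ultimately show thesis using that[OF g, of e] by auto
qed

lemma dim_lift_eq:
  assumes B: "coordinate_set {..<n} B" and \<gamma>: "\<gamma> \<in> realizations r n M" and q: "outside r M q \<gamma>"
  shows "dim_lift r n M q \<gamma> = card B"
proof -
  obtain g e where g: "bij_betw g {..<card B} B" and e: "\<And>j. e j \<in> lift_solutions \<gamma> {..<n}"
    and eg: "\<And>i j. i < card B \<Longrightarrow> j < card B \<Longrightarrow> e j (g i) = (if i = j then 1 else 0)"
    using coordinate_basis[OF B \<gamma>] by metis
  have gn: "g i < n" if "i < card B" for i
    using g B that by (auto simp: bij_betw_def coordinate_set_def)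
  let ?d = "card B" and ?L = "lift_space r n M q \<gamma>"
  \<comment> \<open>The linear isomorphism that sends coordinates on \<open>B\<close> to the solution with these values.\<close>
  define T where "T v = vec n (\<lambda>p. \<Sum>j<?d. v $ j * e j p)" for v :: "complex vec"
  interpret D: vec_space "TYPE(complex)" ?d .
  interpret N: vec_space "TYPE(complex)" n .
  have L_iff: "z \<in> ?L \<longleftrightarrow> z \<in> carrier_vec n \<and> (\<lambda>p. z $ p) \<in> lift_solutions \<gamma> {..<n}" for z
    using lift_space_iff[OF \<gamma> q] by (auto simp: lift_space_def)
  have T_mem: "T v \<in> ?L" for v
  proof -
    have "(\<lambda>p. \<Sum>j<?d. v $ j * e j p) \<in> lift_solutions \<gamma> {..<n}"
      by (rule lift_solutions_lincomb) (rule e)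
    then have "(\<lambda>p. T v $ p) \<in> lift_solutions \<gamma> {..<n}"
      by (rule lift_solutions_cong) (simp add: T_def)
    moreover have "T v \<in> carrier_vec n" by (simp add: T_def)
    ultimately show ?thesis using L_iff by blast
  qed
  have linear: "x \<cdot>\<^sub>v v + y \<cdot>\<^sub>v w \<in> ?L" if "v \<in> ?L" "w \<in> ?L" for x y v w
  proof -
    have vw: "v \<in> carrier_vec n" "w \<in> carrier_vec n" using that L_iff by blast+
    have "(\<lambda>p. x * v $ p + y * w $ p) \<in> lift_solutions \<gamma> {..<n}"
      by (rule lift_solutions_linear) (use that L_iff in blast)+
    then have "(\<lambda>p. (x \<cdot>\<^sub>v v + y \<cdot>\<^sub>v w) $ p) \<in> lift_solutions \<gamma> {..<n}"
      by (rule lift_solutions_cong) (use vw in simp)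
    moreover have "x \<cdot>\<^sub>v v + y \<cdot>\<^sub>v w \<in> carrier_vec n" using vw by simp
    ultimately show ?thesis using L_iff by blast
  qed
  have sub: "submodule class_ring ?L N.V"
  proof
    show "?L \<subseteq> carrier N.V" by (auto simp: L_iff)
    show "\<zero>\<^bsub>N.V\<^esub> \<in> ?L" by (auto simp: L_iff lift_solutions_def)
  next
    fix v w assume "v \<in> ?L" "w \<in> ?L"
    then show "v \<oplus>\<^bsub>N.V\<^esub> w \<in> ?L" using linear[of v w 1 1] by simp
  next
    fix c :: complex and v assume v: "v \<in> ?L"
    have "c \<cdot>\<^sub>v v + 0 \<cdot>\<^sub>v v = c \<cdot>\<^sub>v v" using v by (intro eq_vecI) (auto simp: L_iff)
    then show "c \<odot>\<^bsub>N.V\<^esub> v \<in> ?L" using linear[OF v v, of c 0] by simp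
  qed
  have "VectorSpace.subspace class_ring ?L N.V"
    using sub N.vectorspace_axioms by (simp add: VectorSpace.subspace_def)
  then have vs: "vectorspace class_ring (N.vs ?L)" by (rule N.subspace_is_vs)
  interpret W: vectorspace class_ring "N.vs ?L" by (rule vs)
  interpret T: linear_map class_ring D.V "N.vs ?L" T
  proof
    have "T (v + w) = T v + T w" if "v \<in> carrier_vec ?d" "w \<in> carrier_vec ?d" for v w
      using that by (intro eq_vecI) (auto simp: T_def distrib_right sum.distrib)
    moreover have "T (c \<cdot>\<^sub>v v) = c \<cdot>\<^sub>v T v" if "v \<in> carrier_vec ?d" for c v
      using that by (intro eq_vecI) (auto simp: T_def sum_distrib_left mult.assoc)
    ultimately show "T \<in> LinearCombinations.module_hom class_ring D.V (N.vs ?L)"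
      using T_mem by (auto simp: LinearCombinations.module_hom_def)
  qed
  have Tg: "T v $ g i = v $ i" if "i < ?d" for v i
  proof -
    have "T v $ g i = (\<Sum>j<?d. v $ j * e j (g i))" using gn[OF that] by (simp add: T_def)
    also have "\<dots> = (\<Sum>j<?d. if i = j then v $ j else 0)"
      using eg[OF that] by (intro sum.cong) auto
    finally have "T v $ g i = (\<Sum>j<?d. if i = j then v $ j else 0)" .
    then show ?thesis using that by simp
  qed
  have inj: "inj_on T (carrier D.V)"
  proof (rule inj_onI)
    fix v w assume vw: "v \<in> carrier D.V" "w \<in> carrier D.V" "T v = T w"
    then have "v $ i = w $ i" if "i < ?d" for i using Tg[OF that] by metis
    then show "v = w" using vw by (intro eq_vecI) auto
  qed
  have surj: "T ` carrier D.V = carrier (N.vs ?L)"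
  proof (intro equalityI subsetI)
    fix z assume "z \<in> carrier (N.vs ?L)"
    then have z: "z \<in> carrier_vec n" "(\<lambda>p. z $ p) \<in> lift_solutions \<gamma> {..<n}" by (auto simp: L_iff)
    define v where "v = vec ?d (\<lambda>i. z $ g i)"
    define w where "w = (\<lambda>p. 1 * z $ p + (- 1) * T v $ p)"
    have w: "w \<in> lift_solutions \<gamma> {..<n}"
      unfolding w_def by (rule lift_solutions_linear) (use z T_mem L_iff in auto)
    have "w b = 0" if "b \<in> B" for b
    proof -
      have "b \<in> g ` {..<?d}" using g that by (simp add: bij_betw_def)
      then obtain i where "i < ?d" "b = g i" by blast
      then show ?thesis using Tg[of i v] by (simp add: v_def w_def)
    qed
    then have "w x = 0" if "x < n" for x
      using coordinate_set_unique[OF B \<gamma> w, of x] that by simp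
    then have "z $ x = T v $ x" if "x < n" for x using that by (simp add: w_def)
    then have "z = T v" using z(1) by (intro eq_vecI) (auto simp: T_def)
    then show "z \<in> T ` carrier D.V" by (auto simp: v_def)
  qed (use T_mem in auto)
  have "vectorspace.dim class_ring D.V = vectorspace.dim class_ring (N.vs ?L)"
    by (rule T.dim_eq[OF D.fin_dim inj surj])
  then show ?thesis by (simp add: dim_lift_def D.dim_is_n)
qed

lemma matroid_dim_eq:
  assumes B: "coordinate_set {..<n} B" and "realizations r n M \<noteq> {}"
  shows "matroid_dim r n M = card B"
proof -
  obtain \<gamma> q where \<gamma>: "\<gamma> \<in> realizations r n M" "outside r M q \<gamma>"
    using assms(2) outside_exists by blast
  show ?thesis
    unfolding matroid_dim_def
  proof (rule the_equality)
    show "\<forall>\<gamma>\<in>realizations r n M. \<forall>q. outside r M q \<gamma> \<longrightarrow> dim_lift r n M q \<gamma> = card B"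
      using dim_lift_eq[OF B] by blast
  next
    fix d assume "\<forall>\<gamma>\<in>realizations r n M. \<forall>q. outside r M q \<gamma> \<longrightarrow> dim_lift r n M q \<gamma> = d"
    then show "d = card B" using \<gamma> dim_lift_eq[OF B \<gamma>] by auto
  qed
qed

text \<open>
  Vanishing on \<open>Z\<close> is a system of fewer than \<open>|B|\<close> equations for the \<open>|B|\<close> coordinates.
\<close>

lemma supported_lift_solution:
  assumes B: "coordinate_set {..<n} B" and \<gamma>: "\<gamma> \<in> realizations r n M"
    and Z: "Z \<subseteq> {..<n}" "card Z < card B"
  obtains z where "z \<in> lift_solutions \<gamma> {..<n}" "\<exists>p<n. z p \<noteq> 0" "\<And>p. p \<in> Z \<Longrightarrow> z p = 0"
proof -
  obtain g e where g: "bij_betw g {..<card B} B" and e: "\<And>j. e j \<in> lift_solutions \<gamma> {..<n}"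
    and eg: "\<And>i j. i < card B \<Longrightarrow> j < card B \<Longrightarrow> e j (g i) = (if i = j then 1 else 0)"
    using coordinate_basis[OF B \<gamma>] by metis
  obtain v where v: "\<exists>j \<in> {..<card B}. v j \<noteq> 0"
    "\<And>p. p \<in> Z \<Longrightarrow> (\<Sum>j \<in> {..<card B}. e j p * v j) = 0"
    by (rule underdetermined_system[of "{..<card B}" Z "\<lambda>p j. e j p"])
      (use Z finite_subset[OF Z(1)] in auto)
  let ?z = "\<lambda>p. \<Sum>j<card B. v j * e j p"
  obtain i where i: "i < card B" "v i \<noteq> 0" using v(1) by auto
  have "?z (g i) = (\<Sum>j<card B. if i = j then v j else 0)"
    using eg[OF i(1)] by (intro sum.cong) auto
  then have "?z (g i) \<noteq> 0" using i by simp
  moreover have "g i < n" using g B i by (auto simp: bij_betw_def coordinate_set_def)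
  moreover have "?z \<in> lift_solutions \<gamma> {..<n}" by (rule lift_solutions_lincomb) (rule e)
  moreover have "?z p = 0" if "p \<in> Z" for p using v(2)[OF that] by (simp add: mult.commute)
  ultimately show thesis using that[of ?z] by blast
qed

end

section \<open>The rows of the liftability matrix\<close>

text \<open>
  The value of a bracket is the determinant with the columns of \<open>\<gamma>\<close> in place of the generic
  ones, and a bracket only involves the indeterminates of \<open>\<complex>[X]\<close>.
\<close>

lemma eval_bracket:
  assumes \<gamma>: "\<gamma> \<in> carrier_mat r n" and q: "q \<in> carrier_vec r" and K: "K \<subseteq> {..<r}"
    and vs: "set vs \<subseteq> {..<n}" "Suc (length vs) = card K"
  shows "poly_eval (bracket r n q K vs) \<gamma> = det (mat (card K) (card K)
    (\<lambda>(i, j). if j < length vs then \<gamma> $$ (pick K i, vs ! j) else q $ pick K i))"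
    and "bracket r n q K vs \<in> poly_ring r n"
proof -
  let ?X = "mat_of_cols r (map (col (generic_matrix r n)) vs @ [map_vec Const q])"
  let ?E = "\<lambda>i j. if j < length vs then Var (pick K i, vs ! j) else Const (q $ pick K i)"
  have "{i. i < dim_row ?X \<and> i \<in> K} = K" "{j. j < dim_col ?X \<and> j \<in> UNIV} = {..<card K}"
    using K vs by auto
  then have dims: "dim_row (submatrix ?X K UNIV) = card K" "dim_col (submatrix ?X K UNIV) = card K"
    "card {i. i < dim_row ?X \<and> i \<in> K} = card K" "card {j. j < dim_col ?X \<and> j \<in> UNIV} = card K"
    by (simp_all only: dim_submatrix card_lessThan)
  have pick: "pick K i < r" if "i < card K" for i
    using K pick_in_set_le[OF that] by auto
  have entry: "submatrix ?X K UNIV $$ (i, j) = ?E i j" if i: "i < card K" and j: "j < card K" for i j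
  proof -
    have jl: "j < Suc (length vs)" using j vs(2) by simp
    have "submatrix ?X K UNIV $$ (i, j) = ?X $$ (pick K i, j)"
      using submatrix_index[of i ?X K j UNIV] dims i j by (simp add: pick_UNIV)
    also have "\<dots> = (map (col (generic_matrix r n)) vs @ [map_vec Const q]) ! j $ pick K i"
      using jl pick[OF i] by (intro mat_of_cols_index) auto
    also have "\<dots> = ?E i j"
    proof (cases "j < length vs")
      case True
      then have "vs ! j < n" using vs(1) by (meson lessThan_iff nth_mem subsetD)
      then show ?thesis using True pick[OF i] by (simp add: nth_append generic_matrix_def)
    next
      case False
      then have "j = length vs" using jl by simp
      then show ?thesis using pick[OF i] q by (simp add: nth_append)
    qed
    finally show ?thesis .
  qed
  have "map_mat (\<lambda>f. poly_eval f \<gamma>) (submatrix ?X K UNIV) = mat (card K) (card K)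
    (\<lambda>(i, j). if j < length vs then \<gamma> $$ (pick K i, vs ! j) else q $ pick K i)"
    by (rule eq_matI) (use dims entry in auto)
  then show "poly_eval (bracket r n q K vs) \<gamma> = det (mat (card K) (card K)
    (\<lambda>(i, j). if j < length vs then \<gamma> $$ (pick K i, vs ! j) else q $ pick K i))"
    unfolding bracket_def using poly_eval.hom_det[of \<gamma> "submatrix ?X K UNIV"] by simp
  show "bracket r n q K vs \<in> poly_ring r n"
    unfolding bracket_def
  proof (rule poly_ring_det)
    fix i j assume "i < dim_row (submatrix ?X K UNIV)" "j < dim_col (submatrix ?X K UNIV)"
    then have ij: "i < card K" "j < card K" using dims by auto
    show "submatrix ?X K UNIV $$ (i, j) \<in> poly_ring r n"
      unfolding entry[OF ij]
      using pick[OF ij(1)] subsetD[OF vs(1) nth_mem[of j vs]] by (auto intro!: poly_ring_Var)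
  qed
qed

lemma card_less_nth_sorted:
  assumes "sorted_wrt (<) (xs :: nat list)" "j < length xs"
  shows "card {x \<in> set xs. x < xs ! j} = j"
proof -
  have "{x \<in> set xs. x < xs ! j} = (!) xs ` {..<j}"
  proof (intro equalityI subsetI)
    fix x assume "x \<in> {x \<in> set xs. x < xs ! j}"
    then obtain i where i: "i < length xs" "x = xs ! i" "xs ! i < xs ! j"
      by (auto simp: in_set_conv_nth)
    then have "i < j"
      using sorted_wrt_nth_less[OF assms(1), of j i] by (metis less_asym' less_irrefl linorder_neqE_nat)
    then show "x \<in> (!) xs ` {..<j}" using i by auto
  next
    fix x assume "x \<in> (!) xs ` {..<j}"
    then show "x \<in> {x \<in> set xs. x < xs ! j}"
      using sorted_wrt_nth_less[OF assms(1)] assms(2) by auto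
  qed
  moreover have "inj_on ((!) xs) {..<j}"
    using assms by (auto simp: inj_on_def nth_eq_iff_index_eq strict_sorted_iff)
  ultimately show ?thesis by (simp add: card_image)
qed

context ranked_matroid begin

text \<open>
  Let \<open>k = |c|\<close>. The matrix \<open>A\<close> in the proof has the columns \<open>(\<gamma>\<^sub>p|\<^sub>K, z\<^sub>p)\<close> for \<open>p \<in> c\<close> and the
  last column \<open>(q|\<^sub>K, 0)\<close>. The first \<open>k\<close> columns satisfy the relation of \<open>c\<close>, and expansion
  along the last row gives the product of the row \<open>(c, K)\<close> with \<open>z\<close>, up to the sign \<open>(-1)\<^sup>k\<close>.
\<close>

lemma liftability_row_kills:
  assumes \<gamma>: "\<gamma> \<in> realizations r n M" and q: "q \<in> carrier_vec r"
    and R: "(c, K) \<in> liftability_rows r M" and z: "z \<in> lift_solutions \<gamma> {..<n}"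
  shows "(\<Sum>p<n. poly_eval (liftability_matrix r n q (c, K) p) \<gamma> * z p) = 0"
proof -
  note g = realization_carrier[OF \<gamma>]
  have c: "circuit M c" and K: "K \<subseteq> {..<r}" "card K = card c"
    using R by (auto simp: liftability_rows_def)
  have cr: "card c \<le> r" using K card_mono[of "{..<r}" K] by simp
  have cn: "c \<subseteq> {..<n}" and fin: "finite c" using circuit_ground circuit_finite c by auto
  define k where "k = card c"
  define cl where "cl = sorted_list_of_set c"
  have cl: "set cl = c" "length cl = k" "distinct cl" "sorted_wrt (<) cl"
    using fin by (auto simp: cl_def k_def)
  have bij: "bij_betw ((!) cl) {..<k} c" using cl by (intro bij_betw_nth) auto
  have cl_n: "cl ! j < n" if "j < k" for j using that cl cn nth_mem[of j cl] by auto
  have pick: "pick K i < r" if "i < k" for i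
    using K pick_in_set_le[of i K] that by (auto simp: k_def)
  \<comment> \<open>The last column \<open>k\<close> belongs to \<open>q\<close>, the last row \<open>k\<close> to \<open>z\<close>.\<close>
  define A where "A = mat (Suc k) (Suc k) (\<lambda>(i, j).
    if i < k then (if j < k then \<gamma> $$ (pick K i, cl ! j) else q $ pick K i)
    else (if j < k then z (cl ! j) else 0))"
  have A: "A \<in> carrier_mat (Suc k) (Suc k)" by (simp add: A_def)
  obtain a where a: "linear_relation \<gamma> c a" "\<And>p. p \<in> c \<Longrightarrow> a p \<noteq> 0"
    using circuit_relation[OF \<gamma> c] by blast
  have sum_cl: "(\<Sum>j<k. f (cl ! j)) = (\<Sum>p<n. f p)" if "\<And>p. p \<notin> c \<Longrightarrow> f p = 0" for f :: "nat \<Rightarrow> complex"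
  proof -
    have "(\<Sum>j<k. f (cl ! j)) = (\<Sum>p\<in>c. f p)" by (rule sum.reindex_bij_betw[OF bij])
    also have "\<dots> = (\<Sum>p<n. f p)" using cn that by (intro sum.mono_neutral_left) auto
    finally show ?thesis .
  qed
  have a0: "a p = 0" if "p \<notin> c" for p using that linear_relation_support[OF a(1)] by blast
  define v where "v = vec (Suc k) (\<lambda>j. if j < k then a (cl ! j) else 0)"
  have "A *\<^sub>v v = 0\<^sub>v (Suc k)"
  proof (rule eq_vecI)
    fix i assume "i < dim_vec (0\<^sub>v (Suc k) :: complex vec)"
    then have i: "i < Suc k" by simp
    have "(A *\<^sub>v v) $ i = (\<Sum>j<Suc k. A $$ (i, j) * v $ j)"
      using i A by (simp add: scalar_prod_def v_def atLeast0LessThan)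
    also have "\<dots> = (\<Sum>j<k. A $$ (i, j) * a (cl ! j))" by (simp add: v_def)
    also have "\<dots> = 0"
    proof (cases "i < k")
      case True
      then have "(\<Sum>j<k. A $$ (i, j) * a (cl ! j)) = (\<Sum>j<k. a (cl ! j) * \<gamma> $$ (pick K i, cl ! j))"
        by (intro sum.cong) (auto simp: A_def)
      also have "\<dots> = (\<Sum>p<n. a p * \<gamma> $$ (pick K i, p))"
        by (rule sum_cl[of "\<lambda>p. a p * \<gamma> $$ (pick K i, p)"]) (simp add: a0)
      also have "\<dots> = 0" using a(1) g pick[OF True] by (auto simp: linear_relation_def)
      finally show ?thesis .
    next
      case False
      then have "(\<Sum>j<k. A $$ (i, j) * a (cl ! j)) = (\<Sum>j<k. a (cl ! j) * z (cl ! j))"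
        using i by (intro sum.cong) (auto simp: A_def)
      also have "\<dots> = (\<Sum>p<n. a p * z p)"
        by (rule sum_cl[of "\<lambda>p. a p * z p"]) (simp add: a0)
      also have "\<dots> = 0" by (rule lift_solutionsD[OF z c cn cr a(1)])
      finally show ?thesis .
    qed
    finally show "(A *\<^sub>v v) $ i = 0\<^sub>v (Suc k) $ i" using i by simp
  qed (use A in auto)
  moreover have "v \<noteq> 0\<^sub>v (Suc k)"
  proof -
    have "0 < k" using circuit_nonempty[OF c] fin by (simp add: k_def card_gt_0_iff)
    then have "v $ 0 \<noteq> 0" using a(2) cl nth_mem[of 0 cl] by (simp add: v_def)
    then show ?thesis by auto
  qed
  moreover have "v \<in> carrier_vec (Suc k)" by (simp add: v_def)
  ultimately have "det A = 0" using det_0_iff_vec_prod_zero_field[OF A] by blast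
  moreover have "det A = (\<Sum>j<Suc k. A $$ (k, j) * cofactor A k j)"
    by (rule laplace_expansion_row[OF A]) simp
  moreover have "\<dots> = (\<Sum>j<k. A $$ (k, j) * cofactor A k j)" by (simp add: A_def)
  moreover have "A $$ (k, j) * cofactor A k j =
    (- 1) ^ k * (poly_eval (liftability_matrix r n q (c, K) (cl ! j)) \<gamma> * z (cl ! j))" if j: "j < k" for j
  proof -
    let ?vs = "sorted_list_of_set (c - {cl ! j})"
    have "?vs = remove1 (cl ! j) cl"
      using fin by (simp add: cl_def sorted_list_of_set_remove)
    also have "\<dots> = take j cl @ drop (Suc j) cl"
    proof -
      have split: "cl = take j cl @ cl ! j # drop (Suc j) cl"
        using j cl(2) by (simp add: id_take_nth_drop)
      then have "distinct (take j cl @ cl ! j # drop (Suc j) cl)" using cl(3) by simp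
      then have "remove1 (cl ! j) (take j cl @ cl ! j # drop (Suc j) cl) = take j cl @ drop (Suc j) cl"
        by (simp add: remove1_append)
      then show ?thesis using split by simp
    qed
    finally have vs: "?vs = take j cl @ drop (Suc j) cl" .
    have vs_nth: "?vs ! i = cl ! (if i < j then i else Suc i)" if "i < k - 1" for i
      using that j cl(2) by (auto simp: vs nth_append)
    have vs_len: "length ?vs = k - 1" using j cl(2) by (simp add: vs)
    have "mat_delete A k j = mat (card K) (card K)
      (\<lambda>(i, j). if j < length ?vs then \<gamma> $$ (pick K i, ?vs ! j) else q $ pick K i)"
    proof (rule eq_matI)
      fix i i' assume "i < dim_row (mat (card K) (card K)
        (\<lambda>(i, j). if j < length ?vs then \<gamma> $$ (pick K i, ?vs ! j) else q $ pick K i))"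
        "i' < dim_col (mat (card K) (card K)
        (\<lambda>(i, j). if j < length ?vs then \<gamma> $$ (pick K i, ?vs ! j) else q $ pick K i))"
      then have i: "i < k" "i' < k" using K by (auto simp: k_def)
      then show "mat_delete A k j $$ (i, i') = mat (card K) (card K)
        (\<lambda>(i, j). if j < length ?vs then \<gamma> $$ (pick K i, ?vs ! j) else q $ pick K i) $$ (i, i')"
        using K j vs_nth[of i'] vs_len by (auto simp: mat_delete_def A_def k_def)
    qed (use K in \<open>auto simp: mat_delete_def A_def k_def\<close>)
    also have "det \<dots> = poly_eval (bracket r n q K ?vs) \<gamma>"
      using vs_len j K cn fin by (intro eval_bracket(1)[symmetric] g q) (auto simp: k_def)
    finally have "det (mat_delete A k j) = poly_eval (bracket r n q K ?vs) \<gamma>" .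
    moreover have "card {x \<in> c. x < cl ! j} = j"
      using card_less_nth_sorted[OF cl(4), of j] j cl by simp
    moreover have "cl ! j \<in> c" using j cl nth_mem by metis
    moreover have "A $$ (k, j) = z (cl ! j)" using j by (simp add: A_def)
    ultimately show ?thesis
      by (simp add: cofactor_def power_add poly_eval_mult poly_eval.hom_power poly_eval.hom_uminus)
  qed
  ultimately have "0 = (\<Sum>j<k. (- 1) ^ k * (poly_eval (liftability_matrix r n q (c, K) (cl ! j)) \<gamma> * z (cl ! j)))"
    by simp
  then have "(\<Sum>j<k. poly_eval (liftability_matrix r n q (c, K) (cl ! j)) \<gamma> * z (cl ! j)) = 0"
    by (simp flip: sum_distrib_left)
  moreover have "(\<Sum>j<k. poly_eval (liftability_matrix r n q (c, K) (cl ! j)) \<gamma> * z (cl ! j)) =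
    (\<Sum>p<n. poly_eval (liftability_matrix r n q (c, K) p) \<gamma> * z p)"
    by (rule sum_cl[of "\<lambda>p. poly_eval (liftability_matrix r n q (c, K) p) \<gamma> * z p"]) simp
  ultimately show ?thesis by simp
qed

lemma liftability_matrix_poly_ring:
  assumes "q \<in> carrier_vec r" "(c, K) \<in> liftability_rows r M"
  shows "liftability_matrix r n q (c, K) p \<in> poly_ring r n"
proof (cases "p \<in> c")
  case True
  have c: "circuit M c" "K \<subseteq> {..<r}" "card K = card c"
    using assms(2) by (auto simp: liftability_rows_def)
  have "finite c" "c \<subseteq> {..<n}" using circuit_ground circuit_finite c by auto
  moreover have "Suc (card (c - {p})) = card c" using \<open>finite c\<close> True by (rule card_Suc_Diff1)
  ultimately have "bracket r n q K (sorted_list_of_set (c - {p})) \<in> poly_ring r n"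
    using c by (intro eval_bracket(2)[OF zero_carrier_mat assms(1)]) auto
  then show ?thesis using True by (auto intro!: poly_ring_mult poly_ring_neg_one_power)
qed simp

text \<open>
  The square matrix of the minor, evaluated at \<open>\<gamma>\<close>, annihilates a nonzero solution supported on
  the chosen columns.
\<close>

lemma minor_vanishes:
  assumes B: "coordinate_set {..<n} B" and \<gamma>: "\<gamma> \<in> realizations r n M" and q: "q \<in> carrier_vec r"
    and f: "f \<in> minors (n - card B + 1) (liftability_rows r M) {..<n} (liftability_matrix r n q)"
  shows "poly_eval f \<gamma> = 0"
proof -
  let ?m = "n - card B + 1"
  obtain rs cs where f_def: "f = det (mat ?m ?m (\<lambda>(i, j). liftability_matrix r n q (rs ! i) (cs ! j)))"
    and rs: "length rs = ?m" "set rs \<subseteq> liftability_rows r M"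
    and cs: "distinct cs" "length cs = ?m" "set cs \<subseteq> {..<n}"
    using f by (auto simp: minors_def)
  let ?e = "\<lambda>R p. poly_eval (liftability_matrix r n q R p) \<gamma>"
  have "card B \<le> n" using B card_mono[of "{..<n}" B] by (simp add: coordinate_set_def)
  \<comment> \<open>In particular \<open>card B > 0\<close>, since for \<open>card B = 0\<close> there are no \<open>n + 1\<close> distinct columns.\<close>
  moreover have "?m \<le> n" using cs distinct_card[OF cs(1)] card_mono[of "{..<n}" "set cs"] by simp
  moreover have "card ({..<n} - set cs) = n - ?m"
    using cs distinct_card[OF cs(1)] by (simp add: card_Diff_subset)
  ultimately have "card ({..<n} - set cs) < card B" by simp
  then obtain z where z: "z \<in> lift_solutions \<gamma> {..<n}" "\<exists>p<n. z p \<noteq> 0"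
    "\<And>p. p \<in> {..<n} - set cs \<Longrightarrow> z p = 0"
    using supported_lift_solution[OF B \<gamma>, of "{..<n} - set cs"] by blast
  define A where "A = mat ?m ?m (\<lambda>(i, j). ?e (rs ! i) (cs ! j))"
  define v where "v = vec ?m (\<lambda>j. z (cs ! j))"
  have A: "A \<in> carrier_mat ?m ?m" by (simp add: A_def)
  have "A *\<^sub>v v = 0\<^sub>v ?m"
  proof (rule eq_vecI)
    fix i assume "i < dim_vec (0\<^sub>v ?m :: complex vec)"
    then have i: "i < ?m" by simp
    have "rs ! i \<in> liftability_rows r M" using i rs nth_mem[of i rs] by auto
    then have "(\<Sum>p<n. ?e (rs ! i) p * z p) = 0"
      using liftability_row_kills[OF \<gamma> q _ z(1)] by (cases "rs ! i") auto
    moreover have "(\<Sum>p<n. ?e (rs ! i) p * z p) = (\<Sum>p\<in>set cs. ?e (rs ! i) p * z p)"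
      using cs z(3) by (intro sum.mono_neutral_right) auto
    moreover have "\<dots> = (\<Sum>j<?m. ?e (rs ! i) (cs ! j) * z (cs ! j))"
      using bij_betw_nth[OF cs(1), of "{..<?m}" "set cs"] cs(2)
      by (intro sum.reindex_bij_betw[symmetric]) auto
    moreover have "(A *\<^sub>v v) $ i = (\<Sum>j<?m. ?e (rs ! i) (cs ! j) * z (cs ! j))"
      using i by (simp add: A_def v_def scalar_prod_def atLeast0LessThan)
    ultimately show "(A *\<^sub>v v) $ i = 0\<^sub>v ?m $ i" using i by simp
  qed (simp add: A_def)
  moreover have "v \<noteq> 0\<^sub>v ?m"
  proof -
    obtain p where p: "p < n" "z p \<noteq> 0" using z(2) by blast
    then have "p \<in> set cs" using z(3) by auto
    then obtain j where "j < ?m" "cs ! j = p" using cs(2) by (metis in_set_conv_nth)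
    then have "v $ j \<noteq> 0\<^sub>v ?m $ j" using p by (simp add: v_def)
    then show ?thesis by metis
  qed
  moreover have "v \<in> carrier_vec ?m" by (simp add: v_def)
  ultimately have "det A = 0" using det_0_iff_vec_prod_zero_field[OF A] by blast
  moreover have "A = map_mat (\<lambda>f. poly_eval f \<gamma>) (mat ?m ?m (\<lambda>(i, j). liftability_matrix r n q (rs ! i) (cs ! j)))"
    by (rule eq_matI) (auto simp: A_def)
  ultimately show ?thesis by (simp add: f_def)
qed

end

section \<open>Membership in the matroid ideal\<close>

text \<open>
  The zero locus of \<open>f\<close> is a Zariski closed set that contains the realizations. This covers
  matroids without realizations, whose ideal is the whole ring.
\<close>

lemma vanishing_on_realizations:
  assumes "f \<in> poly_ring r n" "\<And>\<gamma>. \<gamma> \<in> realizations r n M \<Longrightarrow> poly_eval f \<gamma> = 0"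
  shows "f \<in> matroid_ideal r n M"
proof -
  have "zariski_closed r n (zero_locus r n {f})"
    using assms(1) by (auto simp: zariski_closed_def)
  moreover have "realizations r n M \<subseteq> zero_locus r n {f}"
    using assms(2) by (auto simp: zero_locus_def realizations_def)
  ultimately have "matroid_variety r n M \<subseteq> zero_locus r n {f}"
    unfolding matroid_variety_def by (intro hull_minimal)
  then show ?thesis
    using assms(1) by (auto simp: matroid_ideal_def vanishing_ideal_def zero_locus_def)
qed

theorem theorem3p39:
  fixes M :: "nat matroid" and r n :: nat and q :: "complex vec"
  assumes "is_matroid M"
    and "ground M = {..<n}"
    and "matroid_rank M = r"
    and "nilpotent_matroid M"
    and "q \<in> carrier_vec r"
  shows "minors (n - matroid_dim r n M + 1) (liftability_rows r M) {..<n} (liftability_matrix r n q)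
           \<subseteq> matroid_ideal r n M"
proof
  interpret ranked_matroid M r n by unfold_locales fact+
  fix f assume f: "f \<in> minors (n - matroid_dim r n M + 1) (liftability_rows r M) {..<n} (liftability_matrix r n q)"
  obtain B where B: "coordinate_set {..<n} B"
    using nilpotent_coordinate_set assms(4) by blast
  show "f \<in> matroid_ideal r n M"
  proof (rule vanishing_on_realizations)
    show "f \<in> poly_ring r n"
    proof -
      obtain m rs cs where f_def: "f = det (mat m m (\<lambda>(i, j). liftability_matrix r n q (rs ! i) (cs ! j)))"
        and rs: "length rs = m" "set rs \<subseteq> liftability_rows r M"
        using f by (auto simp: minors_def)
      have "liftability_matrix r n q (rs ! i) p \<in> poly_ring r n" if "i < m" for i p
      proof -
        have "rs ! i \<in> liftability_rows r M" using that rs nth_mem[of i rs] by auto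
        then show ?thesis using liftability_matrix_poly_ring[OF assms(5)] by (metis surj_pair)
      qed
      then show ?thesis unfolding f_def by (intro poly_ring_det) simp
    qed
  next
    fix \<gamma> assume \<gamma>: "\<gamma> \<in> realizations r n M"
    then have "matroid_dim r n M = card B" using matroid_dim_eq[OF B] by blast
    then show "poly_eval f \<gamma> = 0" using minor_vanishes[OF B \<gamma> assms(5)] f by simp
  qed
qed

end
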